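(* Let $X$ be a compact Hausdorff space, let $E$ and $F$ be Banach spaces over $\mathbb{K}$, and let $V$ be a linear subspace of $C(X,E)$. Every continuous linear operator $T\colon V \to F^*$ is uniquely extendable to a linear operator $\bar{T}\colon \mathscr{M}(V) \to F^*$ with the following property: whenever $f_n \in \mathscr{M}(V)$ $(n\geq 1)$ are uniformly bounded and converge pointwise to $f \in \mathscr{M}(V)$ in the weak topology of $E$, then $\bar{T} f_n$ converge to $\bar{T} f$ in the weak* topology of $F^*$. Moreover, $\bar{T}$ is continuous and $\|\bar{T}\| = \|T\|$.
   Context: $\mathbb{K}$ is the field of real or complex numbers (fixed). For a nonempty set $Z$, $\ell_\infty(Z,E)$ is the Banach space of all bounded functions $Z\to E$ with the sup-norm induced by the norm of $E$. $C(X,E)\subset \ell_\infty(X,E)$ is the subspace of all continuous functions $X\to E$. For a set $A \subset \ell_\infty(Z,E)$, $\mathscr{M}(A)$ denotes the smallest set among all $B\subset \ell_\infty(Z,E)$ such that: (M0) $A\subset B$; (M1) whenever $f_n\in B$ are uniformly bounded and converge pointwise to $f\in\ell_\infty(Z,E)$ in the weak topology of $E$, then $f\in B$. If $V$ is a linear subspace, then so is $\mathscr{M}(V)$. Here $\mathscr{M}(V)$ is formed in $\ell_\infty(X,E)$ and carries the sup-norm. *)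

theory Defs
  imports "HOL-Analysis.Analysis" "HOL-Library.Function_Algebras"
begin

(* The scalar field K. Up to isometric field isomorphism the instances of this class are exactly
   real and complex, so a free type variable 'k::real_or_complex ranges over both cases. *)
class real_or_complex = real_normed_field +
  assumes real_or_complex:
    "(\<exists>h :: 'a \<Rightarrow> real. bij h \<and> (\<forall>x y. h (x + y) = h x + h y) \<and>
        (\<forall>x y. h (x * y) = h x * h y) \<and> (\<forall>x. norm (h x) = norm x)) \<or>
     (\<exists>h :: 'a \<Rightarrow> complex. bij h \<and> (\<forall>x y. h (x + y) = h x + h y) \<and>
        (\<forall>x y. h (x * y) = h x * h y) \<and> (\<forall>x. norm (h x) = norm x))"

instance real :: real_or_complex
  by standard (intro disjI1 exI[of _ "\<lambda>x::real. x"], auto simp: bij_def)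

instance complex :: real_or_complex
  by standard (intro disjI2 exI[of _ "\<lambda>x::complex. x"], auto simp: bij_def)

(* A normed space over K: norm and underlying real structure come from the type, and the scalar
   multiplication by K is an explicit parameter. With 'v::banach this is a Banach space over K. *)
locale K_normed_space = vector_space scale
  for scale :: "'k::real_or_complex \<Rightarrow> 'v::real_normed_vector \<Rightarrow> 'v" +
  assumes scale_of_real: "scale (of_real r) x = r *\<^sub>R x"
    and norm_scale: "norm (scale c x) = norm c * norm x"

lemma K_normed_space_scaleR:
  "K_normed_space (scaleR :: real \<Rightarrow> 'v::real_normed_vector \<Rightarrow> 'v)"
  by unfold_locales (auto simp: algebra_simps)

lemma K_normed_space_mult:
  "K_normed_space ((*) :: 'k::real_or_complex \<Rightarrow> 'k \<Rightarrow> 'k)"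
  by unfold_locales (auto simp: algebra_simps norm_mult scaleR_conv_of_real)

definition fscale :: "('k \<Rightarrow> 'v \<Rightarrow> 'v) \<Rightarrow> 'k \<Rightarrow> ('z \<Rightarrow> 'v) \<Rightarrow> ('z \<Rightarrow> 'v)" where
  "fscale s c f = (\<lambda>z. s c (f z))"

(* Operators defined on a linear subspace A only; values of T outside A are irrelevant.
   Addition of functions is pointwise (Function_Algebras). *)
definition linear_operator ::
  "('k::field \<Rightarrow> 'a::ab_group_add \<Rightarrow> 'a) \<Rightarrow> ('k \<Rightarrow> 'b::ab_group_add \<Rightarrow> 'b) \<Rightarrow> 'a set \<Rightarrow> 'b set \<Rightarrow> ('a \<Rightarrow> 'b) \<Rightarrow> bool" where
  "linear_operator sA sB A B T \<longleftrightarrow>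
     module.subspace sA A \<and> T \<in> A \<rightarrow> B \<and>
     (\<forall>f\<in>A. \<forall>g\<in>A. T (f + g) = T f + T g) \<and>
     (\<forall>c. \<forall>f\<in>A. T (sA c f) = sB c (T f))"

definition linf :: "('z \<Rightarrow> 'v::real_normed_vector) set" where
  "linf = {f. bounded (range f)}"

definition sup_norm :: "('z \<Rightarrow> 'v::real_normed_vector) \<Rightarrow> real" where
  "sup_norm f = (SUP z. norm (f z))"

definition C_space :: "('x::topological_space \<Rightarrow> 'v::real_normed_vector) set" where
  "C_space = {f \<in> linf. continuous_on UNIV f}"

definition dual_space :: "('k::real_normed_field \<Rightarrow> 'v::real_normed_vector \<Rightarrow> 'v) \<Rightarrow> ('v \<Rightarrow> 'k) set" where
  "dual_space s = {\<phi>. bounded_linear \<phi> \<and> (\<forall>c x. \<phi> (s c x) = c * \<phi> x)}"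

(* The topology of the norm N on the subspace A. The absolute value has no effect on A; it only
   keeps the distance nonnegative off A (as Metric_space demands), where N may be a supremum of
   an unbounded set. N is instantiated by sup_norm on linf and by onorm on the dual space. *)
definition norm_topology :: "'a::minus set \<Rightarrow> ('a \<Rightarrow> real) \<Rightarrow> 'a topology" where
  "norm_topology A N = Metric_space.mtopology A (\<lambda>f g. \<bar>N (f - g)\<bar>)"

definition op_norm :: "'a set \<Rightarrow> ('a \<Rightarrow> real) \<Rightarrow> ('b \<Rightarrow> real) \<Rightarrow> ('a \<Rightarrow> 'b) \<Rightarrow> real" where
  "op_norm A N N' T = (SUP f\<in>{f \<in> A. N f \<le> 1}. N' (T f))"

definition weak_topology :: "('k::real_normed_field \<Rightarrow> 'v::real_normed_vector \<Rightarrow> 'v) \<Rightarrow> 'v topology" where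
  "weak_topology s = topology_generated_by {\<phi> -` U | \<phi> U. \<phi> \<in> dual_space s \<and> open U}"

definition weak_star_topology ::
  "('k::real_normed_field \<Rightarrow> 'v::real_normed_vector \<Rightarrow> 'v) \<Rightarrow> ('v \<Rightarrow> 'k) topology" where
  "weak_star_topology s = topology_generated_by {{\<phi> \<in> dual_space s. \<phi> y \<in> U} | y U. open U}"

definition bounded_weak_conv ::
  "('k::real_normed_field \<Rightarrow> 'v::real_normed_vector \<Rightarrow> 'v) \<Rightarrow> (nat \<Rightarrow> 'z \<Rightarrow> 'v) \<Rightarrow> ('z \<Rightarrow> 'v) \<Rightarrow> bool" where
  "bounded_weak_conv s fs f \<longleftrightarrow>
     (\<exists>C. \<forall>n z. norm (fs n z) \<le> C) \<and>
     (\<forall>z. limitin (weak_topology s) (\<lambda>n. fs n z) (f z) sequentially)"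

definition M1_closed ::
  "('k::real_normed_field \<Rightarrow> 'v::real_normed_vector \<Rightarrow> 'v) \<Rightarrow> ('z \<Rightarrow> 'v) set \<Rightarrow> bool" where
  "M1_closed s B \<longleftrightarrow> (\<forall>fs. \<forall>f\<in>linf. (\<forall>n. fs n \<in> B) \<and> bounded_weak_conv s fs f \<longrightarrow> f \<in> B)"

definition M_hull ::
  "('k::real_normed_field \<Rightarrow> 'v::real_normed_vector \<Rightarrow> 'v) \<Rightarrow> ('z \<Rightarrow> 'v) set \<Rightarrow> ('z \<Rightarrow> 'v) set" where
  "M_hull s A = \<Inter>{B. B \<subseteq> linf \<and> A \<subseteq> B \<and> M1_closed s B}"

lemma M_hull_least:
  fixes A :: "('a \<Rightarrow> 'b::real_normed_vector) set"
  assumes "A \<subseteq> linf"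
  shows "M_hull s A \<subseteq> linf" and "A \<subseteq> M_hull s A" and "M1_closed s (M_hull s A)"
    and "\<And>B. B \<subseteq> linf \<Longrightarrow> A \<subseteq> B \<Longrightarrow> M1_closed s B \<Longrightarrow> M_hull s A \<subseteq> B"
proof -
  have "M1_closed s linf" by (simp add: M1_closed_def)
  then show "M_hull s A \<subseteq> linf" using assms by (auto simp: M_hull_def)
  show "A \<subseteq> M_hull s A" by (auto simp: M_hull_def)
  show "M1_closed s (M_hull s A)"
    unfolding M1_closed_def
  proof (intro allI ballI impI, elim conjE)
    fix fs :: "nat \<Rightarrow> 'a \<Rightarrow> 'b" and f
    assume *: "f \<in> linf" "\<forall>n. fs n \<in> M_hull s A" "bounded_weak_conv s fs f"
    show "f \<in> M_hull s A"
      unfolding M_hull_def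
    proof (intro InterI, clarify)
      fix B assume B: "A \<subseteq> B" "M1_closed s B" "B \<subseteq> linf"
      have "\<forall>n. fs n \<in> B" using * B by (auto simp: M_hull_def)
      then show "f \<in> B" using * B by (auto simp: M1_closed_def)
    qed
  qed
  show "M_hull s A \<subseteq> B" if "B \<subseteq> linf" "A \<subseteq> B" "M1_closed s B" for B
    using that by (auto simp: M_hull_def)
qed

lemma Metric_space_sup_norm:
  assumes "A \<subseteq> (linf :: ('z \<Rightarrow> 'v::real_normed_vector) set)"
  shows "Metric_space A (\<lambda>f g. \<bar>sup_norm (f - g)\<bar>)"
proof
  have bdd: "bdd_above (range (\<lambda>z. norm ((f - g) z)))" if "f \<in> A" "g \<in> A" for f g
  proof -
    have "bounded (range f)" "bounded (range g)" using that assms by (auto simp: linf_def)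
    then obtain a b where "\<And>z. norm (f z) \<le> a" "\<And>z. norm (g z) \<le> b"
      by (auto simp: bounded_iff)
    then have "norm ((f - g) z) \<le> a + b" for z
      by (auto intro: norm_triangle_le_diff add_mono)
    then show ?thesis by (auto simp: bdd_above_def)
  qed
  have le: "norm (f z - g z) \<le> sup_norm (f - g)" if "f \<in> A" "g \<in> A" for f g z
    using cSUP_upper[OF UNIV_I bdd[OF that], of z] by (simp add: sup_norm_def)
  have nonneg: "0 \<le> sup_norm (f - g)" if "f \<in> A" "g \<in> A" for f g
    using le[OF that] norm_ge_zero order_trans by blast
  fix f g h :: "'z \<Rightarrow> 'v"
  show "0 \<le> \<bar>sup_norm (f - g)\<bar>" by simp
  show "\<bar>sup_norm (f - g)\<bar> = \<bar>sup_norm (g - f)\<bar>"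
    by (simp add: sup_norm_def norm_minus_commute)
  show "\<bar>sup_norm (f - g)\<bar> = 0 \<longleftrightarrow> f = g" if "f \<in> A" "g \<in> A"
    using le[OF that] by (auto simp: sup_norm_def fun_eq_iff)
  show "\<bar>sup_norm (f - h)\<bar> \<le> \<bar>sup_norm (f - g)\<bar> + \<bar>sup_norm (g - h)\<bar>"
    if "f \<in> A" "g \<in> A" "h \<in> A"
  proof -
    have "norm ((f - h) z) \<le> sup_norm (f - g) + sup_norm (g - h)" for z
      using norm_triangle_ineq[of "f z - g z" "g z - h z"] le[of f g z] le[of g h z] that by simp
    then have "sup_norm (f - h) \<le> sup_norm (f - g) + sup_norm (g - h)"
      unfolding sup_norm_def[of "f - h"] by (intro cSUP_least) auto
    then show ?thesis using nonneg that by simp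
  qed
qed

lemma Metric_space_dual:
  "Metric_space (dual_space s) (\<lambda>\<phi> \<psi>. \<bar>onorm (\<phi> - \<psi>)\<bar>)"
proof
  have bl: "bounded_linear (\<phi> - \<psi>)" if "\<phi> \<in> dual_space s" "\<psi> \<in> dual_space s" for \<phi> \<psi>
    using that bounded_linear_sub[of \<phi> \<psi>] by (simp add: dual_space_def fun_diff_def)
  fix f g h :: "'a \<Rightarrow> 'b"
  show "0 \<le> \<bar>onorm (f - g)\<bar>" by simp
  show "\<bar>onorm (f - g)\<bar> = \<bar>onorm (g - f)\<bar>"
    by (simp add: onorm_def norm_minus_commute)
  show "\<bar>onorm (f - g)\<bar> = 0 \<longleftrightarrow> f = g" if "f \<in> dual_space s" "g \<in> dual_space s"
    using onorm_eq_0[OF bl[OF that]] by (auto simp: fun_eq_iff)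
  show "\<bar>onorm (f - h)\<bar> \<le> \<bar>onorm (f - g)\<bar> + \<bar>onorm (g - h)\<bar>"
    if "f \<in> dual_space s" "g \<in> dual_space s" "h \<in> dual_space s"
    using onorm_triangle[OF bl[of f g] bl[of g h]] that
      onorm_pos_le[OF bl[of f g]] onorm_pos_le[OF bl[of g h]] onorm_pos_le[OF bl[of f h]]
    by (simp add: fun_diff_def)
qed

definition weak_seq_extension ::
  "('k::real_or_complex \<Rightarrow> 'e::banach \<Rightarrow> 'e) \<Rightarrow> ('k \<Rightarrow> 'f::banach \<Rightarrow> 'f) \<Rightarrow> ('x \<Rightarrow> 'e) set \<Rightarrow>
   (('x \<Rightarrow> 'e) \<Rightarrow> 'f \<Rightarrow> 'k) \<Rightarrow> (('x \<Rightarrow> 'e) \<Rightarrow> 'f \<Rightarrow> 'k) \<Rightarrow> bool" where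
  "weak_seq_extension sE sF V T T' \<longleftrightarrow>
     linear_operator (fscale sE) (fscale (*)) (M_hull sE V) (dual_space sF) T' \<and>
     (\<forall>f\<in>V. T' f = T f) \<and>
     (\<forall>fs. \<forall>f\<in>M_hull sE V. (\<forall>n. fs n \<in> M_hull sE V) \<and> bounded_weak_conv sE fs f \<longrightarrow>
        limitin (weak_star_topology sF) (\<lambda>n. T' (fs n)) (T' f) sequentially)"

end

theory Submission
  imports Defs
begin

text \<open>For each \<open>y\<close>, the real part of \<open>f \<mapsto> T f y\<close> is dominated on \<open>V\<close> by a multiple of the supremum of
  \<open>(x, \<psi>) \<mapsto> \<psi> (f x)\<close> over \<open>X\<close> times the unit ball of the real dual of \<open>E\<close>. As that ball is symmetric, no
  absolute value is needed here, and the Hahn--Banach extension to all bounded functions on the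
  product is automatically positive, i.e. a finitely additive measure on all subsets. On the space of
  ultrafilters it becomes countably additive, and since every ultrafilter has a limit point in the
  product, functions \<open>f \<in> V\<close> are integrated correctly. So \<open>T\<close> is represented by measures of total
  mass at most \<open>\<parallel>T\<parallel> \<parallel>y\<parallel>\<close>, integration extends it to the hull of \<open>V\<close>, and dominated convergence
  gives the continuity. Uniqueness and linearity hold because equations between weakly sequentially
  continuous maps pass from \<open>V\<close> to its hull.\<close>

section \<open>The Hahn--Banach theorem\<close>

text \<open>Weak convergence tests with one functional at a time and gives nothing uniform; what
  turns it into convergence of the numbers \<open>T f y\<close> is dominated convergence. Hence
  countably additive measures are wanted, although Hahn--Banach supplies finite additivity only.
  Extending to all bounded functions and passing to ultrafilters buys countable additivity by
  compactness, without Borel sets or regularity on \<open>'x\<close> or the dual ball. The price is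
  a sigma-algebra on the product of which it is known only that \<open>eval_fun f\<close> is
  measurable for \<open>f\<close> in \<open>V\<close>. This is enough: the hull is generated by
  limits of sequences, so measurability follows its induction principle. The constants are kept
  exact for the sake of the norm equality: the mass is computed rather than estimated, and a
  rotation of \<open>y\<close> by a scalar of norm 1 turns the bound on real parts into one on norms
  without loss.\<close>

definition sublinear_on :: "(real \<Rightarrow> 'b::ab_group_add \<Rightarrow> 'b) \<Rightarrow> 'b set \<Rightarrow> ('b \<Rightarrow> real) \<Rightarrow> bool" where
  "sublinear_on s W p \<longleftrightarrow>
     (\<forall>x\<in>W. \<forall>y\<in>W. p (x + y) \<le> p x + p y) \<and> (\<forall>x\<in>W. \<forall>t\<ge>0. p (s t x) \<le> t * p x)"

definition real_linear_on :: "(real \<Rightarrow> 'b::ab_group_add \<Rightarrow> 'b) \<Rightarrow> 'b set \<Rightarrow> ('b \<Rightarrow> real) \<Rightarrow> bool" where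
  "real_linear_on s W L \<longleftrightarrow>
     (\<forall>x\<in>W. \<forall>y\<in>W. L (x + y) = L x + L y) \<and> (\<forall>x\<in>W. \<forall>t. L (s t x) = t * L x)"


text \<open>The scalar multiplication is explicit because one Hahn--Banach theorem has to serve both
  \<open>scaleR\<close> on \<open>'e\<close> and pointwise multiplication on
  \<open>linf\<close>.\<close>

locale real_subspace = vector_space s
  for s :: "real \<Rightarrow> 'b::ab_group_add \<Rightarrow> 'b" +
  fixes W :: "'b set"
  assumes subspace_W: "subspace W"
begin

lemmas W_closed = subspace_add[OF subspace_W] subspace_scale[OF subspace_W]
  subspace_neg[OF subspace_W] subspace_diff[OF subspace_W] subspace_0[OF subspace_W]

lemma sublinear_on_add: "sublinear_on s W p \<Longrightarrow> x \<in> W \<Longrightarrow> y \<in> W \<Longrightarrow> p (x + y) \<le> p x + p y"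
  unfolding sublinear_on_def by blast

lemma sublinear_on_scale_le: "sublinear_on s W p \<Longrightarrow> x \<in> W \<Longrightarrow> 0 \<le> t \<Longrightarrow> p (s t x) \<le> t * p x"
  unfolding sublinear_on_def by blast

lemma sublinear_on_zero: "sublinear_on s W p \<Longrightarrow> p 0 = 0"
proof -
  assume "sublinear_on s W p"
  then show "p 0 = 0"
    using sublinear_on_add[of p 0 0] sublinear_on_scale_le[of p 0 0] W_closed(5) by simp
qed

lemma sublinear_on_minus: "sublinear_on s W p \<Longrightarrow> x \<in> W \<Longrightarrow> 0 \<le> p x + p (- x)"
proof -
  assume *: "sublinear_on s W p" "x \<in> W"
  then have "p (x + - x) \<le> p x + p (- x)" by (intro sublinear_on_add W_closed)
  with sublinear_on_zero[OF *(1)] show ?thesis by simp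
qed

lemma sublinear_on_scale:
  assumes p: "sublinear_on s W p" and x: "x \<in> W" and t: "0 \<le> t"
  shows "p (s t x) = t * p x"
proof (cases "t = 0")
  case True
  then show ?thesis using sublinear_on_zero[OF p] by simp
next
  case False
  have "0 \<le> 1 / t" using t by simp
  then have "p (s (1 / t) (s t x)) \<le> (1 / t) * p (s t x)"
    by (intro sublinear_on_scale_le[OF p W_closed(2)[OF x]])
  then have "p x \<le> (1 / t) * p (s t x)" using False by simp
  then have "t * p x \<le> p (s t x)" using False t by (simp add: field_simps)
  then show ?thesis using sublinear_on_scale_le[OF p x t] by simp
qed

text \<open>The infimal convolution of \<open>p\<close> with the cone \<open>R\<close>: the largest
  sublinear functional on \<open>W\<close> that is below \<open>p\<close> and at most
  \<open>a\<close> at \<open>w\<close> for each \<open>(w, a)\<close> in \<open>R\<close>. With a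
  ray for \<open>R\<close> it gives linearity of minimal functionals, with a graph for
  \<open>R\<close> the extension theorem. \<open>pos\<close> says that the two kinds of constraints
  are compatible.\<close>

lemma sublinear_cone_minorant:
  assumes p: "sublinear_on s W p"
    and R: "R \<subseteq> W \<times> UNIV" "(0, 0) \<in> R"
    and add: "\<And>w a w' a'. (w, a) \<in> R \<Longrightarrow> (w', a') \<in> R \<Longrightarrow> (w + w', a + a') \<in> R"
    and scl: "\<And>w a t. (w, a) \<in> R \<Longrightarrow> 0 \<le> t \<Longrightarrow> (s t w, t * a) \<in> R"
    and pos: "\<And>w a. (w, a) \<in> R \<Longrightarrow> 0 \<le> a + p (- w)"
  obtains q where "sublinear_on s W q" "\<And>x. x \<in> W \<Longrightarrow> q x \<le> p x"
    "\<And>w a. (w, a) \<in> R \<Longrightarrow> q w \<le> a" "\<And>x. x \<notin> W \<Longrightarrow> q x = 0"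
proof -
  define q where "q = (\<lambda>y. if y \<in> W then INF (w, a)\<in>R. p (y - w) + a else 0)"
  have RW: "w \<in> W" if "(w, a) \<in> R" for w a using R that by auto
  \<comment> \<open>Through \<open>pos\<close>, the infimum defining \<open>q\<close> is taken over
    a set bounded below.\<close>
  have lower: "- p (- y) \<le> p (y - w) + a" if y: "y \<in> W" and wa: "(w, a) \<in> R" for y w a
  proof -
    have "p ((y - w) + - y) \<le> p (y - w) + p (- y)"
      by (intro sublinear_on_add[OF p] W_closed y RW[OF wa])
    then show ?thesis using pos[OF wa] by simp
  qed
  have bdd: "bdd_below ((\<lambda>(w, a). p (y - w) + a) ` R)" if "y \<in> W" for y
    using lower[OF that] by (intro bdd_belowI[of _ "- p (- y)"]) auto
  have le: "q y \<le> p (y - w) + a" if "y \<in> W" "(w, a) \<in> R" for y w a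
    using cINF_lower[OF bdd[OF that(1)] that(2)] that by (simp add: q_def)
  have greatest: "c \<le> q y" if "y \<in> W" "\<And>w a. (w, a) \<in> R \<Longrightarrow> c \<le> p (y - w) + a" for c y
    using that R by (auto simp: q_def intro!: cINF_greatest)
  have q0: "q 0 \<le> 0" using le[of 0 0 0] R W_closed sublinear_on_zero[OF p] by simp
  have "sublinear_on s W q"
    unfolding sublinear_on_def
  proof (intro conjI ballI allI impI)
    fix x y assume xy: "x \<in> W" "y \<in> W"
    have "q (x + y) \<le> p (x - w) + a + (p (y - w') + a')" if "(w, a) \<in> R" "(w', a') \<in> R" for w a w' a'
    proof -
      have "p ((x - w) + (y - w')) \<le> p (x - w) + p (y - w')"
        by (intro sublinear_on_add[OF p] W_closed xy RW[OF that(1)] RW[OF that(2)])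
      moreover have "q (x + y) \<le> p ((x + y) - (w + w')) + (a + a')"
        using le[OF W_closed(1)[OF xy] add[OF that]] .
      ultimately show ?thesis by (simp add: algebra_simps)
    qed
    \<comment> \<open>The two infima are taken one after the other, with the other summand moved to
      the left.\<close>
    then have "q (x + y) - (p (x - w) + a) \<le> p (y - w') + a'"
      if "(w, a) \<in> R" "(w', a') \<in> R" for w a w' a'
      using that by fastforce
    then have "q (x + y) - (p (x - w) + a) \<le> q y" if "(w, a) \<in> R" for w a
      using that xy(2) by (intro greatest)
    then have "q (x + y) - q y \<le> p (x - w) + a" if "(w, a) \<in> R" for w a
      using that by fastforce
    then have "q (x + y) - q y \<le> q x" using xy(1) by (intro greatest)
    then show "q (x + y) \<le> q x + q y" by simp
  next
    fix x t assume x: "x \<in> W" and t: "0 \<le> (t::real)"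
    show "q (s t x) \<le> t * q x"
    proof (cases "t = 0")
      case True
      then show ?thesis using q0 by simp
    next
      case False
      have "q (s t x) / t \<le> p (x - w) + a" if wa: "(w, a) \<in> R" for w a
      proof -
        have "q (s t x) \<le> p (s t x - s t w) + t * a"
          by (rule le[OF W_closed(2)[OF x] scl[OF wa t]])
        also have "\<dots> = t * (p (x - w) + a)"
          using sublinear_on_scale[OF p W_closed(4)[OF x RW[OF wa]] t]
          by (simp add: scale_right_diff_distrib algebra_simps)
        finally show ?thesis using t False by (simp add: field_simps)
      qed
      then have "q (s t x) / t \<le> q x" using x by (intro greatest)
      then show ?thesis using t False by (simp add: field_simps)
    qed
  qed
  moreover have "q x \<le> p x" if "x \<in> W" for x using le[of x 0 0] that R by simp
  moreover have "q w \<le> a" if "(w, a) \<in> R" for w a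
    using le[of w w a] that RW sublinear_on_zero[OF p] by auto
  moreover have "q x = 0" if "x \<notin> W" for x using that by (simp add: q_def)
  ultimately show ?thesis using that by blast
qed

text \<open>A minimal sublinear functional is linear, which keeps Zorn's lemma away from partial
  functionals; the value 0 off \<open>W\<close> makes the pointwise order antisymmetric.\<close>

lemma dominated_linear_functional:
  assumes p: "sublinear_on s W p"
  obtains L where "real_linear_on s W L" "\<And>x. x \<in> W \<Longrightarrow> L x \<le> p x"
proof -
  define Q where "Q = {q. sublinear_on s W q \<and> (\<forall>x\<in>W. q x \<le> p x) \<and> (\<forall>x. x \<notin> W \<longrightarrow> q x = 0)}"
  have Q_lower: "- p (- x) \<le> q x" if "q \<in> Q" "x \<in> W" for q x
    using sublinear_on_minus[of q x] that W_closed(3)[OF that(2)] by (force simp: Q_def)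
  \<comment> \<open>The order is reversed, so that Zorn's lemma yields a minimal element and chains
    need lower bounds, namely their pointwise infima.\<close>
  have "\<exists>m\<in>Q. \<forall>q\<in>Q. q \<le> m \<longrightarrow> q = m"
  proof (rule predicate_Zorn[where P = "\<lambda>q r. r \<le> q"])
    show "partial_order_on Q (relation_of (\<lambda>q r. r \<le> q) Q)"
      by (auto simp: partial_order_on_def preorder_on_def refl_on_def trans_def antisym_def
          relation_of_def)
    fix C assume C: "C \<in> Chains (relation_of (\<lambda>q r. r \<le> q) Q)"
    have CQ: "C \<subseteq> Q" and chain: "\<And>q r. q \<in> C \<Longrightarrow> r \<in> C \<Longrightarrow> q \<le> r \<or> r \<le> q"
      using C by (auto simp: Chains_def relation_of_def)
    \<comment> \<open>\<open>p\<close> itself, cut off outside \<open>W\<close> as \<open>Q\<close>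
      demands, serves the empty chain.\<close>
    have p': "(\<lambda>x. if x \<in> W then p x else 0) \<in> Q"
      using p W_closed by (simp add: Q_def sublinear_on_def)
    show "\<exists>u\<in>Q. \<forall>q\<in>C. u \<le> q"
    proof (cases "C = {}")
      case True
      then show ?thesis using p' by blast
    next
      case False
      define u where "u = (\<lambda>x. if x \<in> W then INF q\<in>C. q x else 0)"
      have bdd: "bdd_below ((\<lambda>q. q x) ` C)" if "x \<in> W" for x
        using Q_lower[OF _ that] CQ by (intro bdd_belowI[of _ "- p (- x)"]) auto
      have le: "u x \<le> q x" if "x \<in> W" "q \<in> C" for x q
        using cINF_lower[OF bdd[OF that(1)] that(2)] that by (simp add: u_def)
      have greatest: "c \<le> u x" if "x \<in> W" "\<And>q. q \<in> C \<Longrightarrow> c \<le> q x" for c x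
        using that False by (auto simp: u_def intro!: cINF_greatest)
      have "sublinear_on s W u"
        unfolding sublinear_on_def
      proof (intro conjI ballI allI impI)
        fix x y assume xy: "x \<in> W" "y \<in> W"
        have "u (x + y) \<le> q x + r y" if qr: "q \<in> C" "r \<in> C" for q r
        proof -
          \<comment> \<open>Comparability enters here: a common lower member handles
            \<open>q\<close> and \<open>r\<close> at once, whereas an infimum of arbitrary sublinear
            functionals need not be subadditive.\<close>
          obtain m where m: "m \<in> C" "m \<le> q" "m \<le> r" using chain[OF qr] qr by auto
          have "u (x + y) \<le> m (x + y)" by (rule le[OF W_closed(1)[OF xy] m(1)])
          also have "\<dots> \<le> m x + m y"
            using m CQ by (intro sublinear_on_add[OF _ xy]) (auto simp: Q_def)
          also have "\<dots> \<le> q x + r y" using m by (intro add_mono) (auto simp: le_fun_def)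
          finally show ?thesis .
        qed
        then have "u (x + y) - q x \<le> r y" if "q \<in> C" "r \<in> C" for q r using that by fastforce
        then have "u (x + y) - q x \<le> u y" if "q \<in> C" for q using that xy by (intro greatest)
        then have "u (x + y) - u y \<le> q x" if "q \<in> C" for q using that by fastforce
        then have "u (x + y) - u y \<le> u x" using xy(1) by (intro greatest)
        then show "u (x + y) \<le> u x + u y" by simp
      next
        fix x t assume x: "x \<in> W" and t: "0 \<le> (t::real)"
        have "u (s t x) \<le> t * q x" if q: "q \<in> C" for q
        proof -
          have "u (s t x) \<le> q (s t x)" by (rule le[OF W_closed(2)[OF x] q])
          also have "\<dots> \<le> t * q x"
            using q CQ by (intro sublinear_on_scale_le[OF _ x t]) (auto simp: Q_def)
          finally show ?thesis .
        qed
        note * = this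
        show "u (s t x) \<le> t * u x"
        proof (cases "t = 0")
          case True
          then show ?thesis using * False by fastforce
        next
          case False
          then have "u (s t x) / t \<le> u x"
            using t x * by (intro greatest) (auto simp: field_simps)
          then show ?thesis using t False by (simp add: field_simps)
        qed
      qed
      moreover obtain q0 where "q0 \<in> C" using False by blast
      then have "\<forall>x\<in>W. u x \<le> p x" using le CQ by (force simp: Q_def)
      ultimately have "u \<in> Q" by (simp add: Q_def u_def)
      moreover have "u \<le> q" if "q \<in> C" for q
        using le[OF _ that] CQ that by (auto simp: le_fun_def Q_def u_def)
      ultimately show ?thesis by blast
    qed
  qed
  then obtain m where m: "m \<in> Q" and min: "\<And>q. q \<in> Q \<Longrightarrow> q \<le> m \<Longrightarrow> q = m" by blast
  have sm: "sublinear_on s W m" using m by (simp add: Q_def)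
  have neg: "m (- x) = - m x" if x: "x \<in> W" for x
  proof -
    \<comment> \<open>The ray through \<open>(- x, - m x)\<close>: the minorant of \<open>m\<close>
      that is at most \<open>- m x\<close> at \<open>- x\<close> equals \<open>m\<close> by
      minimality, so \<open>m (- x) \<le> - m x\<close>; sublinearity gives the converse.\<close>
    let ?R = "{(s t (- x), - (t * m x)) | t. 0 \<le> t}"
    obtain q where q: "sublinear_on s W q" "\<And>y. y \<in> W \<Longrightarrow> q y \<le> m y"
      "\<And>w a. (w, a) \<in> ?R \<Longrightarrow> q w \<le> a" "\<And>y. y \<notin> W \<Longrightarrow> q y = 0"
    proof (rule sublinear_cone_minorant[OF sm, of ?R])
      show "?R \<subseteq> W \<times> UNIV" using W_closed x by auto
      show "(0, 0) \<in> ?R" by (auto intro: exI[of _ 0])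
      show "(w + w', a + a') \<in> ?R" if ww: "(w, a) \<in> ?R" "(w', a') \<in> ?R" for w a w' a'
      proof -
        obtain t t' where "0 \<le> t" "0 \<le> t'" "w = s t (- x)" "w' = s t' (- x)"
          "a = - (t * m x)" "a' = - (t' * m x)" using ww by blast
        then show ?thesis
          by (auto intro!: exI[of _ "t + t'"] simp: algebra_simps)
      qed
      show "(s r w, r * a) \<in> ?R" if wa: "(w, a) \<in> ?R" and r: "0 \<le> r" for w a r
      proof -
        obtain t where "0 \<le> t" "w = s t (- x)" "a = - (t * m x)" using wa by blast
        then show ?thesis using r by (auto intro!: exI[of _ "r * t"])
      qed
      show "0 \<le> a + m (- w)" if wa: "(w, a) \<in> ?R" for w a
      proof -
        obtain t where "0 \<le> t" "w = s t (- x)" "a = - (t * m x)" using wa by blast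
        then show ?thesis using sublinear_on_scale[OF sm x, of t] by simp
      qed
    qed (blast intro: that)
    have "q \<in> Q" using q m by (force simp: Q_def)
    moreover have "q y \<le> m y" for y using q(2,4) m by (cases "y \<in> W") (auto simp: Q_def)
    then have "q \<le> m" by (rule le_funI)
    ultimately have "q = m" by (rule min)
    moreover have "q (- x) \<le> - m x" by (rule q(3)) (auto intro: exI[of _ 1])
    ultimately show ?thesis using sublinear_on_minus[OF sm x] by simp
  qed
  have "real_linear_on s W m"
    unfolding real_linear_on_def
  proof (intro conjI ballI allI)
    fix x y assume xy: "x \<in> W" "y \<in> W"
    have "m (x + y) \<le> m x + m y" by (rule sublinear_on_add[OF sm xy])
    moreover have "m (- x + - y) \<le> m (- x) + m (- y)"
      by (intro sublinear_on_add[OF sm] W_closed xy)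
    then have "- m (x + y) \<le> - m x - m y"
      using neg[OF xy(1)] neg[OF xy(2)] neg[OF W_closed(1)[OF xy]] by simp
    ultimately show "m (x + y) = m x + m y" by simp
  next
    fix x t assume x: "x \<in> W"
    show "m (s t x) = t * m x"
    proof (cases "0 \<le> t")
      case True
      then show ?thesis using sublinear_on_scale[OF sm x] by simp
    next
      case False
      then have "m (- s (- t) x) = - (- t * m x)"
        using sublinear_on_scale[OF sm x, of "- t"] neg[OF W_closed(2)[OF x]] by simp
      then show ?thesis by simp
    qed
  qed
  then show ?thesis using that m by (auto simp: Q_def)
qed

text \<open>The functional to be extended is given by its graph \<open>R\<close>.\<close>

theorem hahn_banach:
  assumes p: "sublinear_on s W p"
    and R: "R \<subseteq> W \<times> UNIV" "(0, 0) \<in> R"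
    and add: "\<And>w a w' a'. (w, a) \<in> R \<Longrightarrow> (w', a') \<in> R \<Longrightarrow> (w + w', a + a') \<in> R"
    and scl: "\<And>w a t. (w, a) \<in> R \<Longrightarrow> (s t w, t * a) \<in> R"
    and dom: "\<And>w a. (w, a) \<in> R \<Longrightarrow> a \<le> p w"
  obtains L where "real_linear_on s W L" "\<forall>x\<in>W. L x \<le> p x" "\<forall>(w, a)\<in>R. L w = a"
proof -
  \<comment> \<open>On a graph, which is closed under negation, domination by \<open>p\<close> is
    the compatibility condition of the cone lemma.\<close>
  have neg: "(- w, - a) \<in> R" if "(w, a) \<in> R" for w a using scl[OF that, of "- 1"] by simp
  have pos: "0 \<le> a + p (- w)" if "(w, a) \<in> R" for w a using dom[OF neg[OF that]] by simp
  obtain q where q: "sublinear_on s W q" "\<And>x. x \<in> W \<Longrightarrow> q x \<le> p x"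
    "\<And>w a. (w, a) \<in> R \<Longrightarrow> q w \<le> a"
    using sublinear_cone_minorant[OF p R add scl pos] by metis
  obtain L where L: "real_linear_on s W L" "\<And>x. x \<in> W \<Longrightarrow> L x \<le> q x"
    using dominated_linear_functional[OF q(1)] by metis
  have "L w = a" if wa: "(w, a) \<in> R" for w a
  proof -
    have "w \<in> W" using wa R by auto
    then have "L (s (- 1) w) = - 1 * L w" using L(1) unfolding real_linear_on_def by blast
    moreover have "L w \<le> a" "L (- w) \<le> - a"
      using L(2) q(3) wa neg[OF wa] R by (meson mem_Sigma_iff order_trans subsetD)+
    ultimately show ?thesis by simp
  qed
  moreover have "L x \<le> p x" if "x \<in> W" for x using L(2) q(2) that order_trans by blast
  ultimately show ?thesis using that[of L] L(1) by blast
qed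

end

section \<open>Ultrafilters\<close>

definition ultrafilter :: "'a filter \<Rightarrow> bool" where
  "ultrafilter F \<longleftrightarrow> F \<noteq> bot \<and> (\<forall>P. eventually P F \<or> eventually (\<lambda>x. \<not> P x) F)"

lemma ultrafilter_neq_bot: "ultrafilter F \<Longrightarrow> F \<noteq> bot"
  by (simp add: ultrafilter_def)

lemma ultrafilter_eventually_not:
  assumes "ultrafilter F"
  shows "eventually (\<lambda>x. \<not> P x) F \<longleftrightarrow> \<not> eventually P F"
proof
  assume *: "eventually (\<lambda>x. \<not> P x) F"
  show "\<not> eventually P F"
  proof
    assume "eventually P F"
    with * have "eventually (\<lambda>x. False) F" by eventually_elim simp
    then show False using assms by (simp add: ultrafilter_def)
  qed
qed (use assms in \<open>auto simp: ultrafilter_def\<close>)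

lemma ultrafilter_eventually_disj:
  assumes "ultrafilter F"
  shows "eventually (\<lambda>x. P x \<or> Q x) F \<longleftrightarrow> eventually P F \<or> eventually Q F"
  using ultrafilter_eventually_not[OF assms, of "\<lambda>x. P x \<or> Q x"]
    ultrafilter_eventually_not[OF assms, of P] ultrafilter_eventually_not[OF assms, of Q]
  by (auto simp: eventually_conj_iff)

lemma ultrafilter_principal: "ultrafilter (principal {x})"
  by (auto simp: ultrafilter_def eventually_principal principal_eq_bot_iff)

text \<open>Smaller filters are finer, so an ultrafilter is a minimal proper filter and Zorn's lemma
  is again applied downwards.\<close>

lemma ex_ultrafilter_le:
  assumes "F \<noteq> bot"
  obtains U where "ultrafilter U" "U \<le> F"
proof -
  define A where "A = {G. G \<le> F \<and> G \<noteq> bot}"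
  have "\<exists>U\<in>A. \<forall>G\<in>A. G \<le> U \<longrightarrow> G = U"
  proof (rule predicate_Zorn[where P = "\<lambda>G H. H \<le> G"])
    show "partial_order_on A (relation_of (\<lambda>G H. H \<le> G) A)"
      by (auto simp: partial_order_on_def preorder_on_def refl_on_def trans_def antisym_def
          relation_of_def)
    fix C assume C: "C \<in> Chains (relation_of (\<lambda>G H. H \<le> G) A)"
    have CA: "C \<subseteq> A" and chain: "\<And>G H. G \<in> C \<Longrightarrow> H \<in> C \<Longrightarrow> G \<le> H \<or> H \<le> G"
      using C by (auto simp: Chains_def relation_of_def)
    show "\<exists>U\<in>A. \<forall>G\<in>C. U \<le> G"
    proof (cases "C = {}")
      case True
      then show ?thesis using assms by (auto simp: A_def)
    next
      case False
      have "Inf C \<noteq> bot"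
      proof
        assume "Inf C = bot"
        then have "eventually (\<lambda>x. False) (Inf C)" by simp
        \<comment> \<open>A chain is a filter base, so falsity holding eventually along its infimum
          would already hold along one member.\<close>
        moreover have "\<exists>x\<in>C. x \<le> inf G H" if "G \<in> C" "H \<in> C" for G H
          using chain[OF that] that by (auto intro: inf_greatest)
        ultimately obtain G where "G \<in> C" "eventually (\<lambda>x. False) G"
          using eventually_Inf_base[OF False] by blast
        then show False using CA by (auto simp: A_def trivial_limit_def)
      qed
      moreover obtain G where "G \<in> C" using False by blast
      then have "Inf C \<le> F" using CA by (auto simp: A_def intro: Inf_lower2)
      ultimately show ?thesis by (auto simp: A_def intro!: bexI[of _ "Inf C"] Inf_lower)
    qed
  qed
  then obtain U where U: "U \<in> A" and min: "\<And>G. G \<in> A \<Longrightarrow> G \<le> U \<Longrightarrow> G = U" by blast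
  have "eventually P U \<or> eventually (\<lambda>x. \<not> P x) U" for P
  proof (rule disjCI)
    assume "\<not> eventually (\<lambda>x. \<not> P x) U"
    \<comment> \<open>Adjoining \<open>{x. P x}\<close> keeps the filter proper, so by minimality
      the set already belongs to \<open>U\<close>.\<close>
    then have "inf U (principal {x. P x}) \<noteq> bot"
      by (simp add: trivial_limit_def eventually_inf_principal)
    then have "inf U (principal {x. P x}) = U"
      using U by (intro min) (auto simp: A_def intro: le_infI1)
    then show "eventually P U"
      by (metis eventually_principal inf.cobounded2 le_filter_def mem_Collect_eq)
  qed
  then have "ultrafilter U" using U by (simp add: A_def ultrafilter_def)
  then show ?thesis using that U by (simp add: A_def)
qed

text \<open>Compactness gives a cluster point of the image filter. An ultrafilter decides every
  neighbourhood of it, and a decision against one would contradict clustering.\<close>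

lemma ultrafilter_tendsto_compact:
  fixes g :: "'a \<Rightarrow> 'b::topological_space"
  assumes F: "ultrafilter F" and "compact S" and "eventually (\<lambda>x. g x \<in> S) F"
  obtains l where "l \<in> S" "(g \<longlongrightarrow> l) F"
proof -
  have "eventually (\<lambda>y. y \<in> S) (filtermap g F)" using assms(3) by (simp add: eventually_filtermap)
  moreover have "filtermap g F \<noteq> bot" using F by (simp add: ultrafilter_def filtermap_bot_iff)
  ultimately obtain l where l: "l \<in> S" "inf (nhds l) (filtermap g F) \<noteq> bot"
    using \<open>compact S\<close> unfolding compact_filter by blast
  have "(g \<longlongrightarrow> l) F"
  proof (rule topological_tendstoI, rule ccontr)
    fix U assume U: "open U" "l \<in> U" "\<not> eventually (\<lambda>x. g x \<in> U) F"
    then have "eventually (\<lambda>y. y \<notin> U) (filtermap g F)"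
      using ultrafilter_eventually_not[OF F, of "\<lambda>x. g x \<in> U"] by (simp add: eventually_filtermap)
    moreover have "eventually (\<lambda>y. y \<in> U) (nhds l)" using U by (auto simp: eventually_nhds)
    ultimately have "eventually (\<lambda>y. False) (inf (nhds l) (filtermap g F))"
      unfolding eventually_inf by blast
    then show False using l by (simp add: trivial_limit_def)
  qed
  then show ?thesis using that l by blast
qed

lemma ultrafilter_tendsto_Lim:
  fixes g :: "'a \<Rightarrow> real"
  assumes "ultrafilter F" "bounded (range g)"
  shows "(g \<longlongrightarrow> Lim F g) F"
proof -
  have "compact (closure (range g))" using assms(2) by simp
  then obtain l where l: "(g \<longlongrightarrow> l) F"
    using ultrafilter_tendsto_compact[OF assms(1), of "closure (range g)" g]
      closure_subset[of "range g"] by (auto simp: image_subset_iff)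
  then show ?thesis using tendsto_Lim[of F g l] assms(1) by (simp add: ultrafilter_def)
qed

text \<open>Prepares measurability of \<open>\<lambda>F. Lim F g\<close>: superlevel sets become
  countable unions of clopen sets. The gap \<open>1 / Suc n\<close> is there because values above
  \<open>a\<close> may tend to \<open>a\<close>.\<close>

lemma Lim_ultrafilter_greater_iff:
  fixes g :: "'a \<Rightarrow> real"
  assumes F: "ultrafilter F" and "bounded (range g)"
  shows "a < Lim F g \<longleftrightarrow> (\<exists>n::nat. eventually (\<lambda>x. a + 1 / Suc n < g x) F)"
proof
  have lim: "(g \<longlongrightarrow> Lim F g) F" using assms by (rule ultrafilter_tendsto_Lim)
  assume "a < Lim F g"
  then obtain n where "inverse (real (Suc n)) < Lim F g - a"
    using reals_Archimedean[of "Lim F g - a"] by auto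
  then have "a + 1 / Suc n < Lim F g" by (simp add: field_simps)
  then show "\<exists>n::nat. eventually (\<lambda>x. a + 1 / Suc n < g x) F" using order_tendstoD(1)[OF lim] by blast
next
  have lim: "(g \<longlongrightarrow> Lim F g) F" using assms by (rule ultrafilter_tendsto_Lim)
  assume "\<exists>n::nat. eventually (\<lambda>x. a + 1 / Suc n < g x) F"
  then obtain n :: nat where "eventually (\<lambda>x. a + 1 / Suc n < g x) F" by blast
  then have "a + 1 / Suc n \<le> Lim F g"
    by (intro tendsto_lowerbound[OF lim]) (auto elim: eventually_mono simp: ultrafilter_neq_bot[OF F])
  moreover have "0 < 1 / real (Suc n)" by simp
  ultimately show "a < Lim F g" by linarith
qed

section \<open>Dominated functionals as integrals\<close>

lemma vector_space_fscale:
  assumes "vector_space s" shows "vector_space (fscale s)"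
proof -
  interpret vector_space s by fact
  show ?thesis
    by unfold_locales (auto simp: fscale_def fun_eq_iff scale_right_distrib scale_left_distrib)
qed

lemma linfI: "(\<And>z. norm (f z) \<le> C) \<Longrightarrow> f \<in> linf"
  by (auto simp: linf_def bounded_iff)

lemma linfE:
  assumes "f \<in> linf" obtains C where "0 \<le> C" "\<And>z. norm (f z) \<le> C"
proof -
  obtain C where "\<And>z. norm (f z) \<le> C" using assms by (auto simp: linf_def bounded_iff)
  moreover from this have "0 \<le> C" using norm_ge_zero order_trans by blast
  ultimately show ?thesis using that by blast
qed

lemma linf_lincomb:
  fixes f g :: "'z \<Rightarrow> real"
  assumes "f \<in> linf" "g \<in> linf" shows "(\<lambda>z. a * f z + b * g z) \<in> linf"
proof -
  obtain C D where "\<And>z. norm (f z) \<le> C" "\<And>z. norm (g z) \<le> D" using assms by (meson linfE)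
  then have "norm (a * f z + b * g z) \<le> \<bar>a\<bar> * C + \<bar>b\<bar> * D" for z
    by (intro norm_triangle_le add_mono) (auto simp: abs_mult intro: mult_left_mono)
  then show ?thesis by (rule linfI)
qed

lemma linf_indicator: "(indicator A :: 'z \<Rightarrow> real) \<in> linf"
  by (rule linfI[of _ 1]) (auto simp: indicator_def)

lemma bounded_real_subspace: "real_subspace (fscale (*)) (linf :: ('z \<Rightarrow> real) set)"
proof -
  interpret vector_space "fscale (*) :: real \<Rightarrow> ('z \<Rightarrow> real) \<Rightarrow> 'z \<Rightarrow> real"
    by (intro vector_space_fscale K_normed_space.axioms(1)[OF K_normed_space_mult])
  show ?thesis
  proof
    show "subspace (linf :: ('z \<Rightarrow> real) set)"
      unfolding subspace_def
    proof (intro conjI ballI allI)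
      fix f g :: "'z \<Rightarrow> real" and c assume fg: "f \<in> linf" "g \<in> linf"
      show "f + g \<in> linf" using linf_lincomb[OF fg, of 1 1] by (simp add: plus_fun_def)
      show "fscale (*) c f \<in> linf" using linf_lincomb[OF fg, of c 0] by (simp add: fscale_def)
    qed (auto intro: linfI[of _ 0])
  qed
qed

section \<open>Limits of bounded functions along ultrafilters\<close>

lemma Lim_ultrafilter_lincomb:
  fixes g h :: "'z \<Rightarrow> real"
  assumes F: "ultrafilter F" and "g \<in> linf" "h \<in> linf"
  shows "Lim F (\<lambda>z. a * g z + b * h z) = a * Lim F g + b * Lim F h"
  using assms by (intro tendsto_Lim tendsto_intros ultrafilter_tendsto_Lim)
    (auto simp: ultrafilter_neq_bot linf_def)

lemma Lim_ultrafilter_indicator: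
  assumes F: "ultrafilter F"
  shows "Lim F (indicator A :: 'z \<Rightarrow> real) = of_bool (eventually (\<lambda>z. z \<in> A) F)"
proof (rule tendsto_Lim[OF ultrafilter_neq_bot[OF F]], rule tendsto_eventually)
  show "\<forall>\<^sub>F z in F. indicator A z = (of_bool (eventually (\<lambda>z. z \<in> A) F) :: real)"
  proof (cases "eventually (\<lambda>z. z \<in> A) F")
    case True
    then show ?thesis by (auto elim: eventually_mono)
  next
    case False
    then have "eventually (\<lambda>z. z \<notin> A) F" using ultrafilter_eventually_not[OF F] by blast
    then show ?thesis using False by (auto elim: eventually_mono)
  qed
qed

lemma Lim_ultrafilter_bounds:
  fixes g :: "'z \<Rightarrow> real"
  assumes F: "ultrafilter F" and "\<And>z. a \<le> g z" "\<And>z. g z \<le> b"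
  shows "a \<le> Lim F g" "Lim F g \<le> b"
proof -
  have "norm (g z) \<le> max \<bar>a\<bar> \<bar>b\<bar>" for z using assms(2,3)[of z] by auto
  then have "bounded (range g)" by (auto simp: bounded_iff)
  then have "(g \<longlongrightarrow> Lim F g) F" by (rule ultrafilter_tendsto_Lim[OF F])
  then show "a \<le> Lim F g" "Lim F g \<le> b"
    using assms ultrafilter_neq_bot[OF F]
    by (auto intro: tendsto_lowerbound tendsto_upperbound)
qed

text \<open>The basic clopen sets of the Stone--Cech compactification of the discrete set
  \<open>'z\<close>.\<close>

definition clopen_ultrafilters :: "'z set \<Rightarrow> 'z filter set" where
  "clopen_ultrafilters A = {F. ultrafilter F \<and> eventually (\<lambda>z. z \<in> A) F}"

text \<open>The clopen sets of the space of ultrafilters form an algebra on which, by compactness, every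
  finitely additive set function is countably additive.\<close>

lemma clopen_ultrafilter_measure:
  fixes m :: "'z set \<Rightarrow> real"
  assumes pos: "\<And>A. 0 \<le> m A" and empty: "m {} = 0"
    and add: "\<And>A B. A \<inter> B = {} \<Longrightarrow> m (A \<union> B) = m A + m B"
  obtains M :: "'z filter measure" where "space M = {F. ultrafilter F}"
    "\<And>A. clopen_ultrafilters A \<in> sets M"
    "\<And>A. emeasure M (clopen_ultrafilters A) = ennreal (m A)"
proof -
  define \<Omega> where "\<Omega> = {F :: 'z filter. ultrafilter F}"
  let ?hat = "clopen_ultrafilters :: 'z set \<Rightarrow> 'z filter set"
  \<comment> \<open>Principal ultrafilters embed \<open>'z\<close>, so \<open>core\<close> recovers
    \<open>A\<close> from its clopen set and \<open>f\<close> is well defined.\<close>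
  define core where "core = (\<lambda>S :: 'z filter set. {z. principal {z} \<in> S})"
  define f where "f = (\<lambda>S. ennreal (m (core S)))"
  have core_hat: "core (?hat A) = A" for A
    by (simp add: core_def clopen_ultrafilters_def ultrafilter_principal eventually_principal)
  have hat_Un: "?hat A \<union> ?hat B = ?hat (A \<union> B)" for A B
    using ultrafilter_eventually_disj[of _ "\<lambda>z. z \<in> A" "\<lambda>z. z \<in> B"]
    by (auto simp: clopen_ultrafilters_def)
  have hat_Int: "?hat A \<inter> ?hat B = ?hat (A \<inter> B)" for A B
    by (auto simp: clopen_ultrafilters_def eventually_conj_iff)
  have hat_compl: "\<Omega> - ?hat A = ?hat (- A)" for A
    using ultrafilter_eventually_not[of _ "\<lambda>z. z \<in> A"] by (auto simp: clopen_ultrafilters_def \<Omega>_def)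
  have hat_empty: "?hat {} = {}" by (auto simp: clopen_ultrafilters_def ultrafilter_def)
  interpret algebra \<Omega> "range ?hat"
    unfolding algebra_iff_Un
  proof (intro conjI ballI)
    show "range ?hat \<subseteq> Pow \<Omega>" by (auto simp: clopen_ultrafilters_def \<Omega>_def)
    show "{} \<in> range ?hat" using hat_empty by (metis rangeI)
  qed (auto simp: hat_Un hat_compl)
  have "\<exists>\<mu>. (\<forall>s\<in>range ?hat. \<mu> s = f s) \<and> measure_space \<Omega> (sigma_sets \<Omega> (range ?hat)) \<mu>"
  proof (rule caratheodory_empty_continuous)
    show "positive (range ?hat) f"
      using core_hat[of "{}"] empty by (simp add: positive_def f_def hat_empty)
    show "additive (range ?hat) f"
      unfolding additive_def
    proof (intro ballI impI)
      fix S T assume "S \<in> range ?hat" "T \<in> range ?hat" and disj: "S \<inter> T = {}"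
      then obtain A B where AB: "S = ?hat A" "T = ?hat B" by blast
      have "A \<inter> B = core (?hat (A \<inter> B))" by (simp add: core_hat)
      also have "?hat (A \<inter> B) = ?hat {}" using disj AB by (simp add: hat_empty hat_Int)
      finally have "A \<inter> B = {}" by (simp add: core_hat)
      then show "f (S \<union> T) = f S + f T"
        using add[of A B] pos by (simp add: AB hat_Un f_def core_hat)
    qed
    show "f S \<noteq> \<infinity>" for S by (simp add: f_def)
    fix S assume S: "range S \<subseteq> range ?hat" "decseq S" "(\<Inter>i. S i) = {}"
    define A where "A = (\<lambda>i. core (S i))"
    have SA: "S i = ?hat (A i)" for i
    proof -
      have "S i \<in> range ?hat" using S(1) by blast
      then obtain B where "S i = ?hat B" by blast
      then show ?thesis by (simp add: A_def core_hat)
    qed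
    have dec: "A j \<subseteq> A i" if "i \<le> j" for i j
      using S(2) that by (auto simp: A_def core_def decseq_def)
    \<comment> \<open>Compactness: otherwise the decreasing nonempty sets generate a proper filter,
      and an ultrafilter below it lies in every \<open>S n\<close>. Thus \<open>f (S i)\<close> is
      even eventually 0.\<close>
    have "\<exists>n. A n = {}"
    proof (rule ccontr)
      assume ne: "\<nexists>n. A n = {}"
      have "(INF n. principal (A n)) \<noteq> bot"
      proof
        assume "(INF n. principal (A n)) = bot"
        then have "eventually (\<lambda>x. False) (INF n. principal (A n))" by simp
        moreover have "\<exists>n\<in>UNIV. principal (A n) \<le> inf (principal (A i)) (principal (A j))" for i j
          using dec[of i "max i j"] dec[of j "max i j"] by (intro bexI[of _ "max i j"]) auto
        ultimately obtain n where "eventually (\<lambda>x. False) (principal (A n))"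
          using eventually_INF_base[of UNIV "\<lambda>n. principal (A n)"] by blast
        then show False using ne by (auto simp: eventually_principal)
      qed
      then obtain U where U: "ultrafilter U" "U \<le> (INF n. principal (A n))"
        by (rule ex_ultrafilter_le)
      have "U \<le> principal (A n)" for n using U(2) by (simp add: le_INF_iff)
      then have "U \<in> S n" for n using U(1) by (simp add: SA clopen_ultrafilters_def le_principal)
      then show False using S(3) by blast
    qed
    then obtain n where "A n = {}" by blast
    then have "A i = {}" if "n \<le> i" for i using dec[OF that] by simp
    then have "f (S i) = 0" if "n \<le> i" for i using that empty by (simp add: f_def SA core_hat)
    then show "(\<lambda>i. f (S i)) \<longlonglongrightarrow> 0"
      by (intro tendsto_eventually) (auto simp: eventually_sequentially)
  qed
  then obtain \<mu> where \<mu>: "\<And>A. \<mu> (?hat A) = f (?hat A)"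
    and ms: "measure_space \<Omega> (sigma_sets \<Omega> (range ?hat)) \<mu>" by auto
  define M where "M = measure_of \<Omega> (sigma_sets \<Omega> (range ?hat)) \<mu>"
  have sa: "sigma_algebra \<Omega> (sigma_sets \<Omega> (range ?hat))" using ms by (simp add: measure_space_def)
  have "space M = \<Omega>" "sets M = sigma_sets \<Omega> (range ?hat)"
    unfolding M_def using sigma_algebra.space_measure_of_eq[OF sa]
      sigma_algebra.sets_measure_of_eq[OF sa]
    by simp_all
  moreover have "emeasure M (?hat A) = ennreal (m A)" for A
    using ms sa \<mu> core_hat unfolding M_def
    by (subst emeasure_measure_of_sigma) (auto simp: measure_space_def f_def)
  ultimately show ?thesis using that[of M] by (simp add: clopen_ultrafilters_def \<Omega>_def)
qed

text \<open>The halving step \<open>g \<mapsto> g - (R / 2) * indicator {z. R / 2 \<le> g z}\<close> replaces the approximation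
  of bounded functions by simple ones.\<close>

lemma functional_vanishing_on_indicators:
  fixes D :: "('z \<Rightarrow> real) \<Rightarrow> real"
  assumes lin: "\<And>g h a b. g \<in> linf \<Longrightarrow> h \<in> linf \<Longrightarrow> D (\<lambda>z. a * g z + b * h z) = a * D g + b * D h"
    and ind: "\<And>A. D (indicator A) = 0"
    and bnd: "\<And>g R. g \<in> linf \<Longrightarrow> (\<And>z. 0 \<le> g z) \<Longrightarrow> (\<And>z. g z \<le> R) \<Longrightarrow> \<bar>D g\<bar> \<le> R * c"
    and g: "g \<in> linf"
  shows "D g = 0"
proof -
  have small: "\<bar>D g\<bar> \<le> R * c / 2 ^ n" if "g \<in> linf" "\<And>z. 0 \<le> g z" "\<And>z. g z \<le> R" for g R n
    using that
  proof (induction n arbitrary: g R)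
    case 0
    then show ?case using bnd by simp
  next
    case (Suc n)
    define A where "A = {z. R / 2 \<le> g z}"
    define h where "h = (\<lambda>z. 1 * g z + (- R / 2) * indicator A z)"
    have "h \<in> linf" unfolding h_def by (intro linf_lincomb Suc.prems linf_indicator)
    moreover have "0 \<le> h z" "h z \<le> R / 2" for z
      using Suc.prems(2,3)[of z] by (auto simp: h_def A_def indicator_def)
    ultimately have "\<bar>D h\<bar> \<le> R / 2 * c / 2 ^ n" by (rule Suc.IH)
    moreover have "D h = D g"
      using lin[OF Suc.prems(1) linf_indicator, of 1 "- R / 2" A] by (simp add: h_def ind)
    ultimately show ?case by simp
  qed
  have nonneg: "D g = 0" if g: "g \<in> linf" "\<And>z. 0 \<le> g z" for g
  proof -
    obtain R where "\<And>z. norm (g z) \<le> R" using linfE[OF g(1)] by blast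
    then have "g z \<le> R" for z using abs_ge_self order_trans by fastforce
    then have "\<bar>D g\<bar> \<le> R * c / 2 ^ n" for n by (intro small g)
    moreover have "(\<lambda>n. R * c / 2 ^ n) \<longlonglongrightarrow> 0"
      using tendsto_mult_right_zero[OF LIMSEQ_power_zero[of "1 / 2 :: real"], of "R * c"]
      by (simp add: power_divide)
    ultimately have "\<bar>D g\<bar> \<le> 0" by (intro tendsto_lowerbound[of _ 0 sequentially]) auto
    then show ?thesis by simp
  qed
  obtain R where R: "\<And>z. norm (g z) \<le> R" using linfE[OF g] by blast
  define h where "h = (\<lambda>z. 1 * g z + R * indicator UNIV z)"
  have "D h = 0"
  proof (rule nonneg)
    show "h \<in> linf" unfolding h_def by (intro linf_lincomb g linf_indicator)
    show "0 \<le> h z" for z using R[of z] by (simp add: h_def)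
  qed
  moreover have "D h = D g"
    using lin[OF g linf_indicator, of 1 R UNIV] unfolding h_def ind by simp
  ultimately show ?thesis by simp
qed

lemma real_linear_on_lincomb:
  assumes L: "real_linear_on (fscale (*)) linf L" and gh: "g \<in> linf" "h \<in> linf"
  shows "L (\<lambda>z. a * g z + b * h z) = a * L g + b * L h"
proof -
  interpret real_subspace "fscale (*)" "linf :: ('a \<Rightarrow> real) set" by (rule bounded_real_subspace)
  have "fscale (*) a g \<in> linf" "fscale (*) b h \<in> linf" using gh W_closed(2) by auto
  then have "L (fscale (*) a g + fscale (*) b h) = L (fscale (*) a g) + L (fscale (*) b h)"
    using L unfolding real_linear_on_def by blast
  also have "\<dots> = a * L g + b * L h" using L gh unfolding real_linear_on_def by simp
  finally show ?thesis by (simp add: fscale_def plus_fun_def)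
qed

text \<open>A Riesz representation: \<open>\<lambda>F. Lim F g\<close> is the continuous extension
  of \<open>g\<close> to the space of ultrafilters. Integration and \<open>L\<close> agree on
  indicators, and both lie between 0 and \<open>R * m UNIV\<close> at functions with values between
  0 and \<open>R\<close>, so their difference vanishes by halving.\<close>

lemma positive_functional_integral_Lim:
  fixes L :: "('z \<Rightarrow> real) \<Rightarrow> real"
  assumes L: "real_linear_on (fscale (*)) linf L"
    and pos: "\<And>g. g \<in> linf \<Longrightarrow> (\<forall>z. 0 \<le> g z) \<Longrightarrow> 0 \<le> L g"
  obtains M :: "'z filter measure" where "space M = {F. ultrafilter F}"
    "emeasure M (space M) = ennreal (L (\<lambda>z. 1))"
    "\<And>g :: 'z \<Rightarrow> real. g \<in> linf \<Longrightarrow> (\<lambda>F. Lim F g) \<in> borel_measurable M"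
    "\<And>g. g \<in> linf \<Longrightarrow> integral\<^sup>L M (\<lambda>F. Lim F g) = L g"
proof -
  note lin = real_linear_on_lincomb[OF L]
  define m where "m = (\<lambda>A. L (indicator A))"
  let ?hat = "clopen_ultrafilters :: 'z set \<Rightarrow> 'z filter set"
  have m_pos: "0 \<le> m A" for A unfolding m_def by (intro pos linf_indicator allI) simp
  have "L (\<lambda>z. 0 * indicator {} z + 0 * indicator {} z) = 0"
    using lin[OF linf_indicator linf_indicator, of 0 "{}" 0 "{}"] by simp
  moreover have "indicator {} = (\<lambda>z :: 'z. 0 :: real)" by auto
  ultimately have m_empty: "m {} = 0" by (simp add: m_def)
  have m_add: "m (A \<union> B) = m A + m B" if "A \<inter> B = {}" for A B
  proof -
    have "indicator (A \<union> B) = (\<lambda>z. 1 * indicator A z + 1 * indicator B z :: real)"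
      using that by (auto simp: indicator_def fun_eq_iff)
    then show ?thesis
      using lin[OF linf_indicator linf_indicator, of 1 A 1 B] by (simp add: m_def)
  qed
  obtain M where sp: "space M = {F. ultrafilter F}" and st: "\<And>A. ?hat A \<in> sets M"
    and em: "\<And>A. emeasure M (?hat A) = ennreal (m A)"
    using clopen_ultrafilter_measure[of m] m_pos m_empty m_add by metis
  have total: "emeasure M (space M) = ennreal (m UNIV)"
    using em[of UNIV] by (simp add: sp clopen_ultrafilters_def)
  interpret finite_measure M by standard (simp add: total)
  have meas: "(\<lambda>F. Lim F g) \<in> borel_measurable M" if "g \<in> linf" for g :: "'z \<Rightarrow> real"
    unfolding borel_measurable_iff_greater
  proof
    fix a
    have "{F \<in> space M. a < Lim F g} = (\<Union>n. ?hat {z. a + 1 / Suc n < g z})"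
      using that by (auto simp: sp Lim_ultrafilter_greater_iff linf_def clopen_ultrafilters_def)
    also have "\<dots> \<in> sets M" using st by blast
    finally show "{F \<in> space M. a < Lim F g} \<in> sets M" .
  qed
  have AE_bounds: "AE F in M. a \<le> Lim F g \<and> Lim F g \<le> b"
    if "\<And>z. a \<le> g z" "\<And>z. g z \<le> b" for a b and g :: "'z \<Rightarrow> real"
    using Lim_ultrafilter_bounds[where g = g, OF _ that] by (auto simp: sp)
  have int: "integrable M (\<lambda>F. Lim F g)" if g: "g \<in> linf" for g :: "'z \<Rightarrow> real"
  proof -
    obtain R where "\<And>z. norm (g z) \<le> R" using linfE[OF g] by blast
    then have "- R \<le> g z" "g z \<le> R" for z by (simp_all add: abs_le_iff minus_le_iff)
    then have "AE F in M. norm (Lim F g) \<le> R"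
      using AE_bounds[of "- R" g R] by (simp add: abs_le_iff minus_le_iff)
    then show ?thesis by (rule integrable_const_bound[OF _ meas[OF g]])
  qed
  define I where "I = (\<lambda>g :: 'z \<Rightarrow> real. integral\<^sup>L M (\<lambda>F. Lim F g))"
  have I_lin: "I (\<lambda>z. a * g z + b * h z) = a * I g + b * I h" if "g \<in> linf" "h \<in> linf" for g h a b
  proof -
    have "I (\<lambda>z. a * g z + b * h z) = integral\<^sup>L M (\<lambda>F. a * Lim F g + b * Lim F h)"
      unfolding I_def by (rule Bochner_Integration.integral_cong)
        (auto simp: sp Lim_ultrafilter_lincomb that)
    then show ?thesis using int[OF that(1)] int[OF that(2)] by (simp add: I_def)
  qed
  have I_ind: "I (indicator A) = m A" for A
  proof -
    have "I (indicator A) = integral\<^sup>L M (indicator (?hat A))"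
      unfolding I_def by (rule Bochner_Integration.integral_cong)
        (auto simp: sp Lim_ultrafilter_indicator clopen_ultrafilters_def)
    also have "\<dots> = measure M (?hat A)" using st by simp
    also have "\<dots> = m A" using em m_pos by (simp add: measure_def)
    finally show ?thesis .
  qed
  have one: "indicator UNIV = (\<lambda>z. 1 :: real)" by (auto simp: indicator_def)
  have "L g - I g = 0" if g: "g \<in> linf" for g
  proof (rule functional_vanishing_on_indicators[where D = "\<lambda>g. L g - I g" and c = "m UNIV"])
    fix g :: "'z \<Rightarrow> real" and R assume g: "g \<in> linf" "\<And>z. 0 \<le> g z" "\<And>z. g z \<le> R"
    have "0 \<le> I g" unfolding I_def using Lim_ultrafilter_bounds[where g = g, OF _ g(2,3)]
      by (intro Bochner_Integration.integral_nonneg_AE) (auto simp: sp)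
    moreover have "I g \<le> R * m UNIV"
    proof -
      have "I g \<le> integral\<^sup>L M (\<lambda>F. R)" unfolding I_def
        using Lim_ultrafilter_bounds[where g = g, OF _ g(2,3)]
        by (intro integral_mono int g(1)) (auto simp: sp)
      then show ?thesis using m_pos by (simp add: measure_def total mult.commute)
    qed
    moreover have "0 \<le> L g" using g by (intro pos) auto
    moreover have "L g \<le> R * m UNIV"
    proof -
      \<comment> \<open>Positivity of \<open>L\<close> at the function \<open>R - g\<close>.\<close>
      have "0 \<le> L (\<lambda>z. R * indicator UNIV z + (- 1) * g z)"
        by (intro pos linf_lincomb linf_indicator allI g) (simp add: g)
      also have "\<dots> = R * L (indicator UNIV) - L g"
        using lin[OF linf_indicator g(1), of R UNIV "- 1"] by simp
      finally show ?thesis by (simp add: m_def)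
    qed
    ultimately show "\<bar>L g - I g\<bar> \<le> R * m UNIV" by simp
  next
    show "L (indicator A) - I (indicator A) = 0" for A by (simp add: I_ind m_def)
  qed (use g in \<open>simp_all add: lin I_lin algebra_simps\<close>)
  then have "integral\<^sup>L M (\<lambda>F. Lim F g) = L g" if "g \<in> linf" for g
    using that by (simp add: I_def)
  moreover have "emeasure M (space M) = ennreal (L (\<lambda>z. 1))" using total by (simp add: m_def one)
  ultimately show ?thesis using sp meas by (intro that)
qed

text \<open>The assumption on ultrafilters is compactness of \<open>'z\<close> in the initial topology of the functions
  in the domain of \<open>R\<close>; sending an ultrafilter to a limit point carries the measure over to \<open>'z\<close>.\<close>

theorem dominated_functional_integral:
  fixes R :: "(('z \<Rightarrow> real) \<times> real) set"
  assumes C: "0 \<le> C" and R: "R \<subseteq> linf \<times> UNIV" "(0, 0) \<in> R"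
    and add: "\<And>g a h b. (g, a) \<in> R \<Longrightarrow> (h, b) \<in> R \<Longrightarrow> (g + h, a + b) \<in> R"
    and scl: "\<And>g a t. (g, a) \<in> R \<Longrightarrow> (\<lambda>z. t * g z, t * a) \<in> R"
    and dom: "\<And>g a. (g, a) \<in> R \<Longrightarrow> a \<le> C * (SUP z. g z)"
    and compact: "\<And>F. ultrafilter F \<Longrightarrow> \<exists>z. \<forall>(g, a)\<in>R. (g \<longlongrightarrow> g z) F"
  obtains N :: "'z measure" where "space N = UNIV" "emeasure N UNIV = ennreal C"
    "\<forall>(g, a)\<in>R. g \<in> borel_measurable N \<and> integral\<^sup>L N g = a"
proof -
  interpret real_subspace "fscale (*)" "linf :: ('z \<Rightarrow> real) set" by (rule bounded_real_subspace)
  \<comment> \<open>\<open>p\<close> is nonpositive at nonpositive functions, which makes every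
    linear functional below it positive.\<close>
  define p where "p = (\<lambda>g :: 'z \<Rightarrow> real. C * (SUP z. g z))"
  have bdd: "bdd_above (range g)" if "g \<in> linf" for g :: "'z \<Rightarrow> real"
    using that by (auto simp: linf_def bounded_imp_bdd_above)
  have p: "sublinear_on (fscale (*)) linf p"
    unfolding sublinear_on_def
  proof (intro conjI ballI allI impI)
    fix g h :: "'z \<Rightarrow> real" assume gh: "g \<in> linf" "h \<in> linf"
    have "(SUP z. (g + h) z) \<le> (SUP z. g z) + (SUP z. h z)"
      using bdd gh by (intro cSUP_least) (auto intro!: add_mono cSUP_upper)
    then show "p (g + h) \<le> p g + p h"
      using C by (simp add: p_def mult_left_mono flip: distrib_left)
  next
    fix g :: "'z \<Rightarrow> real" and t :: real assume g: "g \<in> linf" and t: "0 \<le> t"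
    have "(SUP z. t * g z) \<le> t * (SUP z. g z)"
      using bdd[OF g] t by (intro cSUP_least) (auto intro!: mult_left_mono cSUP_upper)
    then have "C * (SUP z. t * g z) \<le> C * (t * (SUP z. g z))" using C by (rule mult_left_mono)
    then show "p (fscale (*) t g) \<le> t * p g" by (simp add: p_def fscale_def ac_simps)
  qed
  obtain L where L: "real_linear_on (fscale (*)) linf L" and Lp': "\<forall>g\<in>linf. L g \<le> p g"
    and LR': "\<forall>(g, a)\<in>R. L g = a"
  proof (rule hahn_banach[OF p R add])
    show "(fscale (*) t g, t * a) \<in> R" if "(g, a) \<in> R" for g a t
      using scl[OF that] by (simp add: fscale_def)
    show "a \<le> p g" if "(g, a) \<in> R" for g a using dom[OF that] by (simp add: p_def)
  qed (assumption | rule that)+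
  have Lp: "L g \<le> p g" if "g \<in> linf" for g using Lp' that by blast
  have LR: "L g = a" if "(g, a) \<in> R" for g a using LR' that by auto
  note lin = real_linear_on_lincomb[OF L]
  have pos: "0 \<le> L g" if g: "g \<in> linf" "\<forall>z. 0 \<le> g z" for g
  proof -
    have m: "(\<lambda>z. (- 1) * g z + 0 * g z) \<in> linf" by (intro linf_lincomb g)
    have "L (\<lambda>z. (- 1) * g z + 0 * g z) \<le> C * (SUP z. (- 1) * g z + 0 * g z)"
      using Lp[OF m] by (simp add: p_def)
    also have "\<dots> \<le> C * 0" using C g by (intro mult_left_mono cSUP_least) auto
    finally show ?thesis using lin[OF g(1) g(1), of "- 1" 0] by simp
  qed
  obtain M where sp: "space M = {F. ultrafilter F}"
    and tot: "emeasure M (space M) = ennreal (L (\<lambda>z. 1))"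
    and meas: "\<And>g :: 'z \<Rightarrow> real. g \<in> linf \<Longrightarrow> (\<lambda>F. Lim F g) \<in> borel_measurable M"
    and int: "\<And>g. g \<in> linf \<Longrightarrow> integral\<^sup>L M (\<lambda>F. Lim F g) = L g"
    using positive_functional_integral_Lim[OF L pos] by metis
  \<comment> \<open>Domination at the constants 1 and -1 bounds the total mass from both
    sides.\<close>
  have L1: "L (\<lambda>z. 1) = C"
  proof -
    have one: "(\<lambda>z :: 'z. 1 :: real) \<in> linf" by (rule linfI[of _ 1]) simp
    then have "(\<lambda>z :: 'z. (- 1) * 1 + 0 * 1 :: real) \<in> linf" by (intro linf_lincomb)
    from Lp[OF this] have "L (\<lambda>z :: 'z. (- 1) * 1 + 0 * 1) \<le> - C" by (simp add: p_def)
    then show ?thesis using Lp[OF one] lin[OF one one, of "- 1" 0] by (simp add: p_def)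
  qed
  define \<pi> where "\<pi> = (\<lambda>F :: 'z filter. SOME z. \<forall>(g, a)\<in>R. (g \<longlongrightarrow> g z) F)"
  have \<pi>: "g (\<pi> F) = Lim F g" if "ultrafilter F" "(g, a) \<in> R" for F g a
  proof -
    have "\<forall>(g, a)\<in>R. (g \<longlongrightarrow> g (\<pi> F)) F"
      unfolding \<pi>_def by (rule someI_ex[OF compact[OF that(1)]])
    then have "(g \<longlongrightarrow> g (\<pi> F)) F" using that(2) by blast
    then show ?thesis using tendsto_Lim[OF ultrafilter_neq_bot[OF that(1)]] by metis
  qed
  \<comment> \<open>The final sigma-algebra, the largest for which \<open>\<pi>\<close> is
    measurable; nothing else is known about the measurability of an arbitrary choice of limit
    points.\<close>
  define \<Sigma> where "\<Sigma> = sigma UNIV {A. \<pi> -` A \<inter> space M \<in> sets M}"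
  have \<pi>_meas: "\<pi> \<in> measurable M \<Sigma>"
    unfolding \<Sigma>_def by (rule measurable_measure_of) auto
  have g_meas: "g \<in> borel_measurable \<Sigma>" if gR: "(g, a) \<in> R" for g a
    unfolding borel_measurable_iff_greater
  proof
    fix c
    have g: "g \<in> linf" using gR R by auto
    have "\<pi> -` {z. c < g z} \<inter> space M = {F \<in> space M. c < Lim F g}"
      using \<pi>[OF _ gR] by (auto simp: sp)
    also have "\<dots> \<in> sets M" using meas[OF g] unfolding borel_measurable_iff_greater by blast
    finally show "{z \<in> space \<Sigma>. c < g z} \<in> sets \<Sigma>" by (simp add: \<Sigma>_def)
  qed
  define N where "N = distr M \<Sigma> \<pi>"
  show ?thesis
  proof (rule that[of N])
    show "space N = UNIV" by (simp add: N_def \<Sigma>_def)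
    show "emeasure N UNIV = ennreal C"
      using emeasure_distr[OF \<pi>_meas, of UNIV] sets.top[of \<Sigma>] by (simp add: N_def \<Sigma>_def tot L1)
    have "g \<in> borel_measurable N \<and> integral\<^sup>L N g = a" if gR: "(g, a) \<in> R" for g a
    proof
      have g: "g \<in> linf" using R gR by auto
      show "g \<in> borel_measurable N" using g_meas[OF gR] by (simp add: N_def)
      have "integral\<^sup>L N g = integral\<^sup>L M (\<lambda>F. g (\<pi> F))"
        unfolding N_def by (rule integral_distr[OF \<pi>_meas g_meas[OF gR]])
      also have "\<dots> = integral\<^sup>L M (\<lambda>F. Lim F g)"
        by (rule Bochner_Integration.integral_cong) (auto simp: sp \<pi>[OF _ gR])
      also have "\<dots> = a" using int[OF g] LR[OF gR] by simp
      finally show "integral\<^sup>L N g = a" .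
    qed
    then show "\<forall>(g, a)\<in>R. g \<in> borel_measurable N \<and> integral\<^sup>L N g = a" by blast
  qed
qed

section \<open>Vector-valued continuous functions\<close>

text \<open>The closed unit ball of the real dual. The one-sided bound is the form in which
  Hahn--Banach delivers functionals; applied to \<open>- e\<close> it bounds the absolute value, and
  so gives continuity.\<close>

definition dual_ball :: "('e::real_normed_vector \<Rightarrow> real) set" where
  "dual_ball = {\<psi>. linear \<psi> \<and> (\<forall>e. \<psi> e \<le> norm e)}"

text \<open>The value 0 off the dual ball lets the whole type \<open>'x \<times> ('e \<Rightarrow> real)\<close> stand in for the product of
  \<open>'x\<close> and the ball.\<close>

definition eval_fun :: "('x \<Rightarrow> 'e::real_normed_vector) \<Rightarrow> 'x \<times> ('e \<Rightarrow> real) \<Rightarrow> real" where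
  "eval_fun f = (\<lambda>(x, \<psi>). if \<psi> \<in> dual_ball then \<psi> (f x) else 0)"

lemma dual_ballD:
  assumes "\<psi> \<in> dual_ball"
  shows "linear \<psi>" "\<bar>\<psi> e\<bar> \<le> norm e"
proof -
  show "linear \<psi>" using assms by (simp add: dual_ball_def)
  have "\<psi> e \<le> norm e" "\<psi> (- e) \<le> norm (- e)" using assms unfolding dual_ball_def by blast+
  then show "\<bar>\<psi> e\<bar> \<le> norm e" using linear_neg[OF \<open>linear \<psi>\<close>, of e] by auto
qed

lemma eval_fun_add: "eval_fun (f + g) = eval_fun f + eval_fun g"
  using linear_add[OF dual_ballD(1)] by (fastforce simp: eval_fun_def fun_eq_iff)

lemma eval_fun_scale: "eval_fun (fscale scaleR t f) = (\<lambda>z. t * eval_fun f z)"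
  using linear_scale[OF dual_ballD(1)] by (fastforce simp: eval_fun_def fscale_def fun_eq_iff)

lemma eval_fun_zero: "eval_fun 0 = 0"
  using linear_0[OF dual_ballD(1)] by (fastforce simp: eval_fun_def fun_eq_iff)

lemma abs_eval_fun_le: "\<bar>eval_fun f (x, \<psi>)\<bar> \<le> norm (f x)"
  using dual_ballD(2) by (auto simp: eval_fun_def)

text \<open>Hahn--Banach for the functional sending \<open>t *\<^sub>R e\<close> to
  \<open>t * norm e\<close>, which the norm dominates. Its description as a graph covers
  \<open>e = 0\<close> as well.\<close>

lemma norming_functional:
  obtains \<psi> where "\<psi> \<in> dual_ball" "\<psi> e = norm (e :: 'e::real_normed_vector)"
proof -
  have "vector_space (scaleR :: real \<Rightarrow> 'e \<Rightarrow> 'e)"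
    by (rule K_normed_space.axioms(1)[OF K_normed_space_scaleR])
  then have "module.subspace scaleR (UNIV :: 'e set)"
    by (simp add: module.subspace_def flip: module_iff_vector_space)
  interpret real_subspace "scaleR :: real \<Rightarrow> 'e \<Rightarrow> 'e" UNIV
    by unfold_locales fact
  let ?R = "range (\<lambda>t. (t *\<^sub>R e, t * norm e))"
  obtain L where L: "real_linear_on scaleR UNIV L" "\<forall>x :: 'e \<in> UNIV. L x \<le> norm x"
    "\<forall>(w, a)\<in>?R. L w = a"
  proof (rule hahn_banach[of norm ?R])
    show "sublinear_on scaleR UNIV (norm :: 'e \<Rightarrow> real)"
      by (simp add: sublinear_on_def norm_triangle_ineq)
    show "(0, 0) \<in> ?R" by (auto intro: image_eqI[of _ _ 0])
    show "(w + w', a + a') \<in> ?R" if "(w, a) \<in> ?R" "(w', a') \<in> ?R" for w a w' a'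
      using that by (auto simp flip: scaleR_add_left distrib_right)
    show "(t *\<^sub>R w, t * a) \<in> ?R" if "(w, a) \<in> ?R" for w a t
      using that by (auto simp flip: mult.assoc)
    show "a \<le> norm w" if "(w, a) \<in> ?R" for w a
      using that by (auto intro!: mult_right_mono)
  qed (simp, rule that)
  have "linear L" using L(1) by (intro linearI) (auto simp: real_linear_on_def)
  then have "L \<in> dual_ball" using L(2) by (simp add: dual_ball_def)
  have "\<forall>t. L (t *\<^sub>R e) = t * norm e" using L(3) by auto
  then have "L (1 *\<^sub>R e) = 1 * norm e" by (rule spec)
  then have "L e = norm e" by simp
  then show ?thesis using that \<open>L \<in> dual_ball\<close> by blast
qed

lemma norm_le_sup_norm: "f \<in> linf \<Longrightarrow> norm (f z) \<le> sup_norm f"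
  unfolding sup_norm_def linf_def
  by (intro cSUP_upper) (auto simp: bounded_iff bdd_above_def)

lemma sup_norm_least: "(\<And>z. norm (f z) \<le> C) \<Longrightarrow> sup_norm f \<le> C"
  unfolding sup_norm_def by (intro cSUP_least) auto

lemma sup_norm_nonneg: "f \<in> linf \<Longrightarrow> 0 \<le> sup_norm f"
  by (rule order_trans[OF norm_ge_zero norm_le_sup_norm])

lemma abs_eval_fun_le_sup_norm: "f \<in> linf \<Longrightarrow> \<bar>eval_fun f z\<bar> \<le> sup_norm f"
  using abs_eval_fun_le[of f "fst z" "snd z"] norm_le_sup_norm[of f "fst z"] by simp

lemma eval_fun_linf: "f \<in> linf \<Longrightarrow> eval_fun f \<in> linf"
  by (intro linfI[of _ "sup_norm f"]) (simp add: abs_eval_fun_le_sup_norm)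

text \<open>A norming functional makes \<open>norm (f x)\<close> a value of
  \<open>eval_fun f\<close>. This converts a bound by \<open>sup_norm\<close> into the one-sided
  bound by a supremum that the integral representation asks for.\<close>

lemma sup_norm_le_SUP_eval_fun:
  assumes "f \<in> linf" shows "sup_norm f \<le> (SUP z. eval_fun f z)"
proof (rule sup_norm_least)
  fix x
  obtain \<psi> where "\<psi> \<in> dual_ball" "\<psi> (f x) = norm (f x)" by (rule norming_functional)
  then have "norm (f x) = eval_fun f (x, \<psi>)" by (simp add: eval_fun_def)
  also have "\<dots> \<le> (SUP z. eval_fun f z)"
    using eval_fun_linf[OF assms] by (intro cSUP_upper) (auto simp: linf_def bounded_imp_bdd_above)
  finally show "norm (f x) \<le> (SUP z. eval_fun f z)" .
qed

text \<open>The limit of an ultrafilter is found coordinatewise: in \<open>'x\<close> by compactness, and in the dual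
  ball as the pointwise limit of functionals.\<close>

lemma eval_fun_ultrafilter_limit:
  fixes F :: "('x::t2_space \<times> ('e::real_normed_vector \<Rightarrow> real)) filter"
  assumes "compact (UNIV :: 'x set)" and F: "ultrafilter F"
  obtains z where "\<forall>f. continuous_on UNIV f \<longrightarrow> (eval_fun f \<longlongrightarrow> eval_fun f z) F"
proof -
  \<comment> \<open>\<open>c e\<close> reads off the value at \<open>e\<close> of the functional
    coordinate, with 0 off the ball.\<close>
  define c :: "'e \<Rightarrow> 'x \<times> ('e \<Rightarrow> real) \<Rightarrow> real" where "c = (\<lambda>e. eval_fun (\<lambda>x. e))"
  define \<psi> where "\<psi> = (\<lambda>e. Lim F (c e))"
  obtain x where x: "(fst \<longlongrightarrow> x) F"
    using ultrafilter_tendsto_compact[OF F assms(1), of fst] by auto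
  have c_le: "\<bar>c e z\<bar> \<le> norm e" for e z
    unfolding c_def by (cases z) (use abs_eval_fun_le[of "\<lambda>x. e"] in auto)
  have lim: "(c e \<longlongrightarrow> \<psi> e) F" for e
    unfolding \<psi>_def using c_le[of e] by (intro ultrafilter_tendsto_Lim[OF F]) (auto simp: bounded_iff)
  have uniq: "l = l'" if "(g \<longlongrightarrow> l) F" "(g \<longlongrightarrow> l') F" for l l' :: real and g
    using tendsto_unique[OF ultrafilter_neq_bot[OF F] that] .
  have "linear \<psi>"
  proof (rule linearI)
    fix e e' :: 'e
    have "c (e + e') = (\<lambda>z. c e z + c e' z)"
      using eval_fun_add[of "\<lambda>x. e" "\<lambda>x. e'"] by (simp add: c_def plus_fun_def)
    then show "\<psi> (e + e') = \<psi> e + \<psi> e'"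
      using tendsto_add[OF lim[of e] lim[of e']] by (intro uniq[OF lim]) simp
  next
    fix t and e :: 'e
    have "c (t *\<^sub>R e) = (\<lambda>z. t * c e z)"
      using eval_fun_scale[of t "\<lambda>x. e"] by (simp add: c_def fscale_def)
    then show "\<psi> (t *\<^sub>R e) = t *\<^sub>R \<psi> e"
      using tendsto_mult_left[OF lim[of e], of t] by (intro uniq[OF lim]) simp
  qed
  moreover have "\<psi> e \<le> norm e" for e
    using abs_le_D1[OF c_le]
    by (intro tendsto_upperbound[OF lim] ultrafilter_neq_bot[OF F] always_eventually) blast
  ultimately have \<psi>: "\<psi> \<in> dual_ball" by (simp add: dual_ball_def)
  have "(eval_fun f \<longlongrightarrow> eval_fun f (x, \<psi>)) F" if f: "continuous_on UNIV f" for f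
  proof -
    have "isCont f x" using f by (simp add: continuous_on_eq_continuous_at)
    then have "((\<lambda>z. f (fst z)) \<longlongrightarrow> f x) F" by (rule isCont_tendsto_compose[OF _ x])
    then have lim0: "((\<lambda>z. norm (f (fst z) - f x)) \<longlongrightarrow> 0) F" by (simp add: LIM_zero tendsto_norm_zero)
    \<comment> \<open>Functionals in the ball are 1-Lipschitz, so freezing the argument at
      \<open>f x\<close> costs an error independent of the functional; off the ball both terms are
      0.\<close>
    have le: "norm (eval_fun f z - c (f x) z) \<le> norm (f (fst z) - f x)" for z
    proof (cases z)
      case (Pair y \<phi>)
      then show ?thesis
        using dual_ballD(2)[of \<phi> "f y - f x"] linear_diff[OF dual_ballD(1), of \<phi> "f y" "f x"]
        by (auto simp: eval_fun_def c_def)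
    qed
    have "((\<lambda>z. eval_fun f z - c (f x) z) \<longlongrightarrow> 0) F"
      by (rule Lim_null_comparison[OF _ lim0]) (simp add: le[unfolded real_norm_def])
    from tendsto_add[OF this lim[of "f x"]] have "(eval_fun f \<longlongrightarrow> \<psi> (f x)) F" by simp
    moreover have "eval_fun f (x, \<psi>) = \<psi> (f x)" using \<psi> by (simp add: eval_fun_def)
    ultimately show ?thesis by simp
  qed
  then show ?thesis using that by blast
qed

text \<open>Domination comes from norming functionals, compactness from the limits of ultrafilters.
  Continuity of the members of \<open>V\<close> enters through the latter only.\<close>

theorem dominated_functional_eval_fun_integral:
  fixes V :: "('x::t2_space \<Rightarrow> 'e::real_normed_vector) set"
  assumes "compact (UNIV :: 'x set)" and V: "V \<subseteq> C_space" "module.subspace (fscale scaleR) V"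
    and u: "real_linear_on (fscale scaleR) V u"
    and C: "0 \<le> C" "\<And>f. f \<in> V \<Longrightarrow> u f \<le> C * sup_norm f"
  obtains N :: "('x \<times> ('e \<Rightarrow> real)) measure" where "emeasure N (space N) = ennreal C"
    "\<And>f. f \<in> V \<Longrightarrow> eval_fun f \<in> borel_measurable N"
    "\<And>f. f \<in> V \<Longrightarrow> integral\<^sup>L N (eval_fun f) = u f"
proof -
  interpret vector_space "fscale scaleR :: real \<Rightarrow> ('x \<Rightarrow> 'e) \<Rightarrow> 'x \<Rightarrow> 'e"
    by (rule vector_space_fscale[OF K_normed_space.axioms(1)[OF K_normed_space_scaleR]])
  interpret real_subspace "fscale scaleR" V using V(2) by unfold_locales
  have V_linf: "f \<in> linf" and V_cont: "continuous_on UNIV f" if "f \<in> V" for f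
    using that V(1) by (auto simp: C_space_def)
  let ?R = "(\<lambda>f. (eval_fun f, u f)) ` V"
  obtain N :: "('x \<times> ('e \<Rightarrow> real)) measure" where N: "space N = UNIV" "emeasure N UNIV = ennreal C"
    "\<forall>(g, a)\<in>?R. g \<in> borel_measurable N \<and> integral\<^sup>L N g = a"
  proof (rule dominated_functional_integral[OF C(1), of ?R])
    show "?R \<subseteq> linf \<times> UNIV" using V_linf eval_fun_linf by auto
    have "u (fscale scaleR 0 0) = 0 * u 0" using u W_closed(5) unfolding real_linear_on_def by blast
    then have "u 0 = 0" by simp
    then show "(0, 0) \<in> ?R" using W_closed(5)
      by (intro image_eqI[of _ _ 0]) (simp_all add: eval_fun_zero)
    show "(g + h, a + b) \<in> ?R" if gh: "(g, a) \<in> ?R" "(h, b) \<in> ?R" for g a h b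
    proof -
      obtain f f' where "f \<in> V" "f' \<in> V" "g = eval_fun f" "a = u f" "h = eval_fun f'" "b = u f'"
        using gh by blast
      then show ?thesis using u W_closed(1)[of f f']
        by (auto simp: real_linear_on_def eval_fun_add intro!: image_eqI[of _ _ "f + f'"])
    qed
    show "(\<lambda>z. t * g z, t * a) \<in> ?R" if g: "(g, a) \<in> ?R" for g a t
    proof -
      obtain f where "f \<in> V" "g = eval_fun f" "a = u f" using g by blast
      then show ?thesis using u W_closed(2)[of f t]
        by (auto simp: real_linear_on_def eval_fun_scale intro!: image_eqI[of _ _ "fscale scaleR t f"])
    qed
    show "a \<le> C * (SUP z. g z)" if g: "(g, a) \<in> ?R" for g a
    proof -
      obtain f where f: "f \<in> V" "g = eval_fun f" "a = u f" using g by blast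
      have "a \<le> C * sup_norm f" using C(2) f by simp
      also have "\<dots> \<le> C * (SUP z. g z)"
        using f C(1) by (auto intro!: mult_left_mono sup_norm_le_SUP_eval_fun V_linf)
      finally show ?thesis .
    qed
    fix F :: "('x \<times> ('e \<Rightarrow> real)) filter" assume "ultrafilter F"
    then obtain z where "\<forall>f :: 'x \<Rightarrow> 'e. continuous_on UNIV f \<longrightarrow> (eval_fun f \<longlongrightarrow> eval_fun f z) F"
      by (rule eval_fun_ultrafilter_limit[OF assms(1)])
    then show "\<exists>z. \<forall>(g, a)\<in>?R. (g \<longlongrightarrow> g z) F" using V_cont by (intro exI[of _ z]) auto
  qed (rule that)
  show ?thesis
  proof (rule that[of N])
    show "emeasure N (space N) = ennreal C" using N by simp
    show "eval_fun f \<in> borel_measurable N" "integral\<^sup>L N (eval_fun f) = u f" if "f \<in> V" for f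
      using N(3) that by auto
  qed
qed

section \<open>Weak convergence and the hull\<close>

text \<open>Eventual membership passes to finite intersections and to unions, so a subbase decides
  convergence. The condition on \<open>\<Union>S\<close> is membership of \<open>l\<close> in the
  underlying space of the topology.\<close>

lemma limitin_topology_generated_by:
  "limitin (topology_generated_by S) f l F \<longleftrightarrow>
     l \<in> \<Union>S \<and> (\<forall>U\<in>S. l \<in> U \<longrightarrow> eventually (\<lambda>n. f n \<in> U) F)"
proof
  assume "limitin (topology_generated_by S) f l F"
  then show "l \<in> \<Union>S \<and> (\<forall>U\<in>S. l \<in> U \<longrightarrow> eventually (\<lambda>n. f n \<in> U) F)"
    by (auto simp: limitin_def intro: topology_generated_by_Basis)
next
  assume *: "l \<in> \<Union>S \<and> (\<forall>U\<in>S. l \<in> U \<longrightarrow> eventually (\<lambda>n. f n \<in> U) F)"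
  have "l \<in> U \<longrightarrow> eventually (\<lambda>n. f n \<in> U) F" if "generate_topology_on S U" for U
    using that
  proof induction
    case (UN K)
    then show ?case by (blast intro: eventually_mono)
  next
    case (Basis U)
    then show ?case using * by blast
  qed (auto intro: eventually_conj)
  then show "limitin (topology_generated_by S) f l F"
    using * by (simp add: limitin_def openin_topology_generated_by_iff)
qed

lemma zero_in_dual_space: "(\<lambda>x. 0) \<in> dual_space s"
  by (simp add: dual_space_def)

lemma limitin_weak_topology_iff:
  "limitin (weak_topology s) f l F \<longleftrightarrow> (\<forall>\<phi>\<in>dual_space s. ((\<lambda>n. \<phi> (f n)) \<longlongrightarrow> \<phi> l) F)"
proof -
  define S where "S = (\<lambda>(\<phi>, U). \<phi> -` U) ` (dual_space s \<times> {U. open U})"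
  have "weak_topology s = topology_generated_by S"
    unfolding weak_topology_def S_def by (rule arg_cong[of _ _ topology_generated_by]) auto
  moreover have "l \<in> \<Union>S" by (force simp: S_def intro: zero_in_dual_space)
  ultimately show ?thesis
    by (simp add: limitin_topology_generated_by tendsto_def S_def split_paired_all)
qed

lemma limitin_weak_star_topology_iff:
  assumes "\<And>n. g n \<in> dual_space s" "l \<in> dual_space s"
  shows "limitin (weak_star_topology s) g l F \<longleftrightarrow> (\<forall>y. ((\<lambda>n. g n y) \<longlongrightarrow> l y) F)"
proof -
  define S where "S = (\<lambda>(y, U). {\<phi> \<in> dual_space s. \<phi> y \<in> U}) ` (UNIV \<times> {U. open U})"
  have "weak_star_topology s = topology_generated_by S"
    unfolding weak_star_topology_def S_def by (rule arg_cong[of _ _ topology_generated_by]) auto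
  moreover have "l \<in> \<Union>S" using assms by (force simp: S_def)
  ultimately show ?thesis
    using assms by (simp add: limitin_topology_generated_by tendsto_def S_def split_paired_all)
qed

section \<open>Bounded weak convergence and the linear structure of the hull\<close>

lemma bounded_weak_conv_iff:
  "bounded_weak_conv s fs f \<longleftrightarrow>
     (\<exists>C. \<forall>n z. norm (fs n z) \<le> C) \<and>
     (\<forall>z. \<forall>\<phi>\<in>dual_space s. (\<lambda>n. \<phi> (fs n z)) \<longlonglongrightarrow> \<phi> (f z))"
  by (simp add: bounded_weak_conv_def limitin_weak_topology_iff)

lemma bounded_weak_conv_const: "f \<in> linf \<Longrightarrow> bounded_weak_conv s (\<lambda>n. f) f"
  by (auto simp: bounded_weak_conv_iff linf_def bounded_iff)

lemma bounded_weak_conv_add: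
  assumes "bounded_weak_conv s fs f" "bounded_weak_conv s gs g"
  shows "bounded_weak_conv s (\<lambda>n. fs n + gs n) (f + g)"
  unfolding bounded_weak_conv_iff
proof (intro conjI allI ballI)
  obtain C D where "\<And>n z. norm (fs n z) \<le> C" "\<And>n z. norm (gs n z) \<le> D"
    using assms unfolding bounded_weak_conv_iff by blast
  then have "norm ((fs n + gs n) z) \<le> C + D" for n z by (simp add: norm_triangle_le add_mono)
  then show "\<exists>C. \<forall>n z. norm ((fs n + gs n) z) \<le> C" by blast
  fix z \<phi> assume \<phi>: "\<phi> \<in> dual_space s"
  then have "bounded_linear \<phi>" by (simp add: dual_space_def)
  then have "\<phi> (x + y) = \<phi> x + \<phi> y" for x y by (rule linear_add[OF bounded_linear.linear])
  then show "(\<lambda>n. \<phi> ((fs n + gs n) z)) \<longlonglongrightarrow> \<phi> ((f + g) z)"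
    using assms \<phi> by (auto simp: bounded_weak_conv_iff intro!: tendsto_add)
qed

lemma bounded_weak_conv_fscale:
  assumes "K_normed_space s" "bounded_weak_conv s fs f"
  shows "bounded_weak_conv s (\<lambda>n. fscale s c (fs n)) (fscale s c f)"
  unfolding bounded_weak_conv_iff
proof (intro conjI allI ballI)
  interpret K_normed_space s by fact
  obtain C where "\<And>n z. norm (fs n z) \<le> C" using assms unfolding bounded_weak_conv_iff by blast
  then have "norm (fscale s c (fs n) z) \<le> norm c * C" for n z
    by (simp add: fscale_def norm_scale mult_left_mono)
  then show "\<exists>C. \<forall>n z. norm (fscale s c (fs n) z) \<le> C" by blast
  fix z \<phi> assume \<phi>: "\<phi> \<in> dual_space s"
  then have "\<phi> (s c x) = c * \<phi> x" for x by (simp add: dual_space_def)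
  then show "(\<lambda>n. \<phi> (fscale s c (fs n) z)) \<longlonglongrightarrow> \<phi> (fscale s c f z)"
    using assms \<phi> by (auto simp: bounded_weak_conv_iff fscale_def intro!: tendsto_mult_left)
qed

text \<open>The members of the hull with property \<open>P\<close> form an \<open>M1_closed\<close>
  set containing \<open>A\<close>, so minimality of the hull applies.\<close>

lemma M_hull_induct [consumes 2, case_names base limit]:
  assumes A: "A \<subseteq> linf" and f: "f \<in> M_hull s A"
    and base: "\<And>f. f \<in> A \<Longrightarrow> P f"
    and lim: "\<And>fs f. (\<And>n. fs n \<in> M_hull s A) \<Longrightarrow> (\<And>n. P (fs n)) \<Longrightarrow> f \<in> M_hull s A \<Longrightarrow>
      bounded_weak_conv s fs f \<Longrightarrow> P f"
  shows "P f"
proof -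
  have "M_hull s A \<subseteq> {f \<in> M_hull s A. P f}"
  proof (rule M_hull_least(4)[OF A])
    show "{f \<in> M_hull s A. P f} \<subseteq> linf" "A \<subseteq> {f \<in> M_hull s A. P f}"
      using M_hull_least(1,2)[OF A, of s] base by auto
    show "M1_closed s {f \<in> M_hull s A. P f}"
      unfolding M1_closed_def
    proof (intro allI ballI impI)
      fix fs f assume f: "f \<in> linf"
        and fs: "(\<forall>n. fs n \<in> {f \<in> M_hull s A. P f}) \<and> bounded_weak_conv s fs f"
      then have "f \<in> M_hull s A"
        using M_hull_least(3)[OF A, of s] unfolding M1_closed_def by blast
      moreover have "P f" by (rule lim[of fs]) (use fs \<open>f \<in> M_hull s A\<close> in auto)
      ultimately show "f \<in> {f \<in> M_hull s A. P f}" by blast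
    qed
  qed
  then show ?thesis using f by blast
qed

lemma M_hull_limit:
  assumes "A \<subseteq> linf" "\<And>n. fs n \<in> M_hull s A" "f \<in> linf" "bounded_weak_conv s fs f"
  shows "f \<in> M_hull s A"
  using M_hull_least(3)[OF assms(1), of s] assms(2-4) unfolding M1_closed_def by blast

lemma fscale_subspace_iff:
  assumes "K_normed_space s"
  shows "module.subspace (fscale s) A \<longleftrightarrow>
    0 \<in> A \<and> (\<forall>f\<in>A. \<forall>g\<in>A. f + g \<in> A) \<and> (\<forall>c. \<forall>f\<in>A. fscale s c f \<in> A)"
  using vector_space_fscale[OF K_normed_space.axioms(1)[OF assms]]
  by (intro module.subspace_def) (simp add: module_iff_vector_space)

lemma linf_add: "f \<in> linf \<Longrightarrow> g \<in> linf \<Longrightarrow> f + g \<in> linf"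
  by (auto simp: linf_def plus_fun_def intro: bounded_plus_comp)

lemma linf_fscale: "K_normed_space s \<Longrightarrow> f \<in> linf \<Longrightarrow> fscale s c f \<in> linf"
  by (rule linfI[of _ "norm c * sup_norm f"])
    (simp add: fscale_def K_normed_space.norm_scale mult_left_mono norm_le_sup_norm)

text \<open>Induction moves one summand at a time, so addition takes two rounds: first with the
  other summand in \<open>A\<close>, then with it anywhere in the hull. The resting summand is a
  constant sequence.\<close>

lemma M_hull_subspace:
  assumes s: "K_normed_space s" and A: "A \<subseteq> linf" and sub: "module.subspace (fscale s) A"
  shows "module.subspace (fscale s) (M_hull s A)"
proof -
  have sub: "0 \<in> A" "\<And>f g. f \<in> A \<Longrightarrow> g \<in> A \<Longrightarrow> f + g \<in> A" "\<And>c f. f \<in> A \<Longrightarrow> fscale s c f \<in> A"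
    using sub by (simp_all add: fscale_subspace_iff[OF s])
  note AM = subsetD[OF M_hull_least(2)[OF A, of s]] and Ml = subsetD[OF M_hull_least(1)[OF A, of s]]
  have scl: "fscale s c f \<in> M_hull s A" if "f \<in> M_hull s A" for c f
    using A that
  proof (induct rule: M_hull_induct)
    case (limit fs f)
    show ?case
      by (rule M_hull_limit[OF A limit(2) linf_fscale[OF s Ml[OF limit(3)]]
            bounded_weak_conv_fscale[OF s limit(4)]])
  qed (simp add: AM sub)
  have add1: "f + g \<in> M_hull s A" if g: "g \<in> A" and f: "f \<in> M_hull s A" for f g
    using A f
  proof (induct rule: M_hull_induct)
    case (limit fs f)
    have "g \<in> linf" using g A by blast
    show ?case
      by (rule M_hull_limit[OF A limit(2) linf_add[OF Ml[OF limit(3)] \<open>g \<in> linf\<close>]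
            bounded_weak_conv_add[OF limit(4) bounded_weak_conv_const[OF \<open>g \<in> linf\<close>]]])
  qed (rule AM[OF sub(2)[OF _ g]])
  have "f + g \<in> M_hull s A" if f: "f \<in> M_hull s A" and g: "g \<in> M_hull s A" for f g
    using A g
  proof (induct rule: M_hull_induct)
    case (limit gs g)
    show ?case
      by (rule M_hull_limit[OF A limit(2) linf_add[OF Ml[OF f] Ml[OF limit(3)]]
            bounded_weak_conv_add[OF bounded_weak_conv_const[OF Ml[OF f]] limit(4)]])
  qed (rule add1[OF _ f])
  then show ?thesis using scl sub AM by (simp add: fscale_subspace_iff[OF s])
qed

text \<open>The codomain is general: it is \<open>real\<close> for the integrals and
  \<open>'k\<close> for \<open>\<lambda>f. T' f y\<close>.\<close>

definition weakly_seq_continuous_on ::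
  "('k::real_normed_field \<Rightarrow> 'v::real_normed_vector \<Rightarrow> 'v) \<Rightarrow> ('z \<Rightarrow> 'v) set \<Rightarrow>
     (('z \<Rightarrow> 'v) \<Rightarrow> 'b::topological_space) \<Rightarrow> bool" where
  "weakly_seq_continuous_on s M U \<longleftrightarrow>
     (\<forall>fs. \<forall>f\<in>M. (\<forall>n. fs n \<in> M) \<and> bounded_weak_conv s fs f \<longrightarrow> (\<lambda>n. U (fs n)) \<longlonglongrightarrow> U f)"

lemma weakly_seq_continuous_on_unique:
  fixes U U' :: "('z \<Rightarrow> 'v::real_normed_vector) \<Rightarrow> 'b::t2_space"
  assumes A: "A \<subseteq> linf" and U: "weakly_seq_continuous_on s (M_hull s A) U"
    and U': "weakly_seq_continuous_on s (M_hull s A) U'"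
    and eq: "\<And>f. f \<in> A \<Longrightarrow> U f = U' f" and f: "f \<in> M_hull s A"
  shows "U f = U' f"
  using A f
proof (induct rule: M_hull_induct)
  case (limit fs f)
  have "(\<lambda>n. U (fs n)) \<longlonglongrightarrow> U f" "(\<lambda>n. U' (fs n)) \<longlonglongrightarrow> U' f"
    using U U' limit(1,3,4) unfolding weakly_seq_continuous_on_def by blast+
  then show "U f = U' f" using limit(2) by (auto intro: LIMSEQ_unique)
qed (rule eq)

section \<open>Real parts of scalars and functionals\<close>

text \<open>Real and imaginary parts in the scalar field: \<open>j\<close> is the imaginary unit in the complex case
  and 0 in the real case, which makes the same formulas valid in both.\<close>

locale scalar_parts =
  fixes \<rho> :: "'k::real_or_complex \<Rightarrow> real" and j :: 'k
  assumes bounded_linear_\<rho>: "bounded_linear \<rho>"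
    and abs_\<rho>_le: "\<bar>\<rho> c\<bar> \<le> norm c"
    and \<rho>_of_real: "\<rho> (of_real r) = r"
    and \<rho>_j_of_real: "\<rho> (j * of_real r) = 0"
    and parts: "c = of_real (\<rho> c) - j * of_real (\<rho> (j * c))"
    and j_square: "j = 0 \<or> j * j = - 1"

text \<open>Ring homomorphisms from the reals into the complex numbers can be wild. Isometry rules
  this out, since the circles around 0 and 1 of radii \<open>\<bar>r\<bar>\<close> and
  \<open>\<bar>r - 1\<bar>\<close> meet in \<open>r\<close> only.\<close>

lemma isometric_ring_hom_of_real:
  fixes h :: "'k::real_normed_field \<Rightarrow> complex"
  assumes add: "\<And>x y. h (x + y) = h x + h y" and mult: "\<And>x y. h (x * y) = h x * h y"
    and norm: "\<And>x. norm (h x) = norm x"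
  shows "h (of_real r) = of_real r"
proof -
  have "h 1 * h 1 = h 1 * 1" using mult[of 1 1] by simp
  moreover have "h 1 \<noteq> 0" using norm[of 1] by auto
  ultimately have h1: "h 1 = 1" by simp
  have diff: "h (x - y) = h x - h y" for x y using add[of "x - y" y] by simp
  define w where "w = h (of_real r)"
  have "cmod w = \<bar>r\<bar>" "cmod (w - 1) = \<bar>r - 1\<bar>"
    using norm[of "of_real r"] norm[of "of_real r - 1"] norm_of_real[of "r - 1", where ?'a = 'k]
    by (simp_all add: w_def diff h1)
  then have "(cmod w)\<^sup>2 = r\<^sup>2" "(cmod (w - 1))\<^sup>2 = (r - 1)\<^sup>2" by simp_all
  then have *: "(Re w)\<^sup>2 + (Im w)\<^sup>2 = r\<^sup>2" "(Re w - 1)\<^sup>2 + (Im w)\<^sup>2 = (r - 1)\<^sup>2"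
    by (simp_all add: cmod_power2)
  then have "Re w = r" by (simp add: power2_eq_square algebra_simps)
  with * have "Im w = 0" by simp
  with \<open>Re w = r\<close> show ?thesis by (simp add: w_def[symmetric] complex_eq_iff)
qed

text \<open>The real field is treated as a subfield of the complex numbers, so that one proof serves
  both alternatives of the class.\<close>

lemma scalar_partsI:
  fixes h :: "'k::real_or_complex \<Rightarrow> complex"
  assumes add: "\<And>x y. h (x + y) = h x + h y" and mult: "\<And>x y. h (x * y) = h x * h y"
    and norm: "\<And>x. norm (h x) = norm x" and inj: "inj h"
    and j: "h j = \<i> \<or> j = 0 \<and> range h \<subseteq> \<real>"
  shows "scalar_parts (\<lambda>c. Re (h c)) j"
proof (rule scalar_parts.intro)
  note of_real = isometric_ring_hom_of_real[of h, OF add mult norm]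
  have diff: "h (x - y) = h x - h y" for x y using add[of "x - y" y] by simp
  have "h (r *\<^sub>R c) = of_real r * h c" for r c by (simp add: scaleR_conv_of_real mult of_real)
  then show "bounded_linear (\<lambda>c. Re (h c))"
    using abs_Re_le_cmod[of "h c" for c] by (intro bounded_linear_intro[of _ 1]) (simp_all add: add norm)
  show "\<bar>Re (h c)\<bar> \<le> norm c" for c using abs_Re_le_cmod[of "h c"] by (simp add: norm)
  show "Re (h (of_real r)) = r" for r by (simp add: of_real)
  have h0: "h 0 = 0" using add[of 0 0] by simp
  show "Re (h (j * of_real r)) = 0" for r using j by (auto simp: mult of_real h0)
  \<comment> \<open>In the complex case this is \<open>c = Re c - \<i> * Re (\<i> * c)\<close>, as
    the real part of \<open>\<i> * c\<close> is minus the imaginary part of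
    \<open>c\<close>.\<close>
  show "c = of_real (Re (h c)) - j * of_real (Re (h (j * c)))" for c
  proof (rule injD[OF inj])
    from j show "h c = h (of_real (Re (h c)) - j * of_real (Re (h (j * c))))"
    proof
      assume "j = 0 \<and> range h \<subseteq> \<real>"
      then have "j = 0" "h c \<in> \<real>" by auto
      then show ?thesis by (simp add: of_real)
    qed (auto simp: add diff mult of_real complex_eq_iff)
  qed
  show "j = 0 \<or> j * j = - 1"
  proof (rule disjCI)
    assume "j * j \<noteq> - 1"
    moreover have "h (j * j) = h (- 1)" if "h j = \<i>"
      using that diff[of 0 1] of_real[of 1] by (simp add: mult h0)
    ultimately show "j = 0" using j injD[OF inj] by blast
  qed
qed

lemma ex_scalar_parts:
  obtains \<rho> and j :: "'k::real_or_complex" where "scalar_parts \<rho> j"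
  using real_or_complex[where ?'a = 'k]
proof (elim disjE exE conjE)
  fix h :: "'k \<Rightarrow> real"
  assume h: "bij h" "\<forall>x y. h (x + y) = h x + h y" "\<forall>x y. h (x * y) = h x * h y"
    "\<forall>x. norm (h x) = norm x"
  have "scalar_parts (\<lambda>c. Re (complex_of_real (h c))) (0 :: 'k)"
    by (rule scalar_partsI) (use h in \<open>auto simp: inj_def bij_def\<close>)
  then show thesis by (rule that)
next
  fix h :: "'k \<Rightarrow> complex"
  assume h: "bij h" "\<forall>x y. h (x + y) = h x + h y" "\<forall>x y. h (x * y) = h x * h y"
    "\<forall>x. norm (h x) = norm x"
  have "h (inv h \<i>) = \<i>" using h(1) by (simp add: bij_def surj_f_inv_f)
  then have "scalar_parts (\<lambda>c. Re (h c)) (inv h \<i>)"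
    by (intro scalar_partsI) (use h in \<open>auto simp: bij_def\<close>)
  then show thesis by (rule that)
qed

context scalar_parts
begin

lemma \<rho>_diff: "\<rho> (x - y) = \<rho> x - \<rho> y" and \<rho>_add: "\<rho> (x + y) = \<rho> x + \<rho> y"
  using bounded_linear_\<rho> by (auto intro: linear_diff linear_add bounded_linear.linear)

lemma \<rho>_of_real_mult: "\<rho> (of_real r * c) = r * \<rho> c"
  using linear_scale[OF bounded_linear.linear[OF bounded_linear_\<rho>], of r c]
  by (simp add: scaleR_conv_of_real)

lemma \<rho>_parts: "\<rho> (of_real a - j * of_real b) = a"
  by (simp add: \<rho>_diff \<rho>_of_real \<rho>_j_of_real)

text \<open>The classical complexification \<open>\<phi> e = \<psi> e - j * \<psi> (s j e)\<close>
  of a real functional. It links the two duals in play: weak convergence tests with functionals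
  linear over \<open>'k\<close>, while the measures live on the real ball.\<close>

lemma dual_ball_eq_\<rho>_dual:
  fixes s :: "'k \<Rightarrow> 'e::real_normed_vector \<Rightarrow> 'e"
  assumes s: "K_normed_space s" and \<psi>: "\<psi> \<in> dual_ball"
  obtains \<phi> where "\<phi> \<in> dual_space s" "\<psi> = \<rho> \<circ> \<phi>"
proof -
  interpret K_normed_space s by fact
  have lin: "linear \<psi>" and le: "\<And>e. \<bar>\<psi> e\<bar> \<le> norm e" using dual_ballD[OF \<psi>] by auto
  have \<psi>_add: "\<psi> (x + y) = \<psi> x + \<psi> y" and \<psi>_scale: "\<psi> (r *\<^sub>R x) = r * \<psi> x" for x y r
    using linear_add[OF lin] linear_scale[OF lin] by simp_all
  define \<phi> where "\<phi> = (\<lambda>e. of_real (\<psi> e) - j * of_real (\<psi> (s j e)))"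
  have \<phi>_add: "\<phi> (x + y) = \<phi> x + \<phi> y" for x y
    by (simp add: \<phi>_def \<psi>_add scale_right_distrib algebra_simps)
  have \<phi>_real: "\<phi> (r *\<^sub>R x) = of_real r * \<phi> x" for r x
  proof -
    have "s j (r *\<^sub>R x) = r *\<^sub>R s j x" by (metis scale_of_real scale_left_commute)
    then show ?thesis by (simp add: \<phi>_def \<psi>_scale algebra_simps)
  qed
  have \<phi>_j: "\<phi> (s j x) = j * \<phi> x" for x
    using j_square
  proof
    assume "j = 0"
    then show ?thesis using \<psi>_scale[of 0 0] by (simp add: \<phi>_def)
  next
    assume jj: "j * j = - 1"
    have "s j (s j x) = (- 1) *\<^sub>R x" using scale_of_real[of "- 1" x] by (simp add: jj)
    then have "\<psi> (s j (s j x)) = - \<psi> x" using \<psi>_scale[of "- 1" x] by simp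
    then have "\<phi> (s j x) = of_real (\<psi> (s j x)) + j * of_real (\<psi> x)"
      unfolding \<phi>_def by (simp del: scale_scale)
    moreover have "j * (j * a) = - a" for a using jj by (metis mult.assoc mult_minus1)
    then have "j * \<phi> x = j * of_real (\<psi> x) + of_real (\<psi> (s j x))"
      unfolding \<phi>_def by (simp add: right_diff_distrib)
    ultimately show ?thesis by simp
  qed
  \<comment> \<open>Every scalar is a real combination of 1 and \<open>j\<close>, and both have been
    treated.\<close>
  have \<phi>_scale: "\<phi> (s c x) = c * \<phi> x" for c x
  proof -
    let ?a = "\<rho> c" and ?b = "- \<rho> (j * c)"
    have c: "c = of_real ?a + j * of_real ?b" using parts[of c] by simp
    have "s c x = ?a *\<^sub>R x + s j (?b *\<^sub>R x)"
      by (subst c) (simp only: scale_left_distrib scale_scale[symmetric] scale_of_real)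
    then have "\<phi> (s c x) = of_real ?a * \<phi> x + j * (of_real ?b * \<phi> x)"
      by (simp only: \<phi>_add \<phi>_j \<phi>_real)
    also have "\<dots> = (of_real ?a + j * of_real ?b) * \<phi> x" by (simp add: algebra_simps)
    finally show ?thesis by (simp only: c[symmetric])
  qed
  have "bounded_linear \<phi>"
  proof (rule bounded_linear_intro[of _ "1 + norm j * norm j"])
    fix x
    have "norm (\<phi> x) \<le> \<bar>\<psi> x\<bar> + norm j * \<bar>\<psi> (s j x)\<bar>"
      unfolding \<phi>_def by (intro norm_triangle_le_diff) (simp add: norm_mult)
    also have "\<dots> \<le> norm x + norm j * (norm j * norm x)"
      using le[of x] le[of "s j x"] by (intro add_mono mult_left_mono) (auto simp: norm_scale)
    finally show "norm (\<phi> x) \<le> norm x * (1 + norm j * norm j)" by (simp add: algebra_simps)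
  qed (simp_all add: \<phi>_add \<phi>_real scaleR_conv_of_real)
  then have "\<phi> \<in> dual_space s" by (simp add: dual_space_def \<phi>_scale)
  moreover have "\<psi> = \<rho> \<circ> \<phi>" by (simp add: fun_eq_iff \<phi>_def \<rho>_parts)
  ultimately show ?thesis by (rule that)
qed

text \<open>Supplies pointwise convergence of the integrands, both for measurability along the hull
  and for dominated convergence.\<close>

lemma bounded_weak_conv_eval_fun:
  fixes s :: "'k \<Rightarrow> 'e::real_normed_vector \<Rightarrow> 'e"
  assumes s: "K_normed_space s" and fs: "bounded_weak_conv s fs f"
  shows "(\<lambda>n. eval_fun (fs n) z) \<longlonglongrightarrow> eval_fun f z"
proof (cases z)
  case (Pair x \<psi>)
  show ?thesis
  proof (cases "\<psi> \<in> dual_ball")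
    case True
    obtain \<phi> where \<phi>: "\<phi> \<in> dual_space s" "\<psi> = \<rho> \<circ> \<phi>"
      by (rule dual_ball_eq_\<rho>_dual[OF s True])
    have "(\<lambda>n. \<phi> (fs n x)) \<longlonglongrightarrow> \<phi> (f x)" using fs \<phi>(1) by (simp add: bounded_weak_conv_iff)
    from bounded_linear.tendsto[OF bounded_linear_\<rho> this] show ?thesis
      using True by (simp add: Pair eval_fun_def \<phi>(2)[symmetric, THEN fun_cong, simplified])
  qed (simp add: Pair eval_fun_def)
qed

end

section \<open>Extension of real functionals to the hull\<close>

lemma real_subspace_of_K_subspace:
  fixes A :: "('z \<Rightarrow> 'v::real_normed_vector) set"
  assumes s: "K_normed_space s" and "module.subspace (fscale s) A"
  shows "module.subspace (fscale scaleR) A"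
proof -
  have "fscale scaleR r f = fscale s (of_real r) f" for r and f :: "'z \<Rightarrow> 'v"
    by (simp add: fscale_def K_normed_space.scale_of_real[OF s])
  then show ?thesis
    using assms(2) by (simp add: fscale_subspace_iff[OF s] fscale_subspace_iff[OF K_normed_space_scaleR])
qed

lemma real_functional_extension:
  fixes V :: "('x::t2_space \<Rightarrow> 'e::real_normed_vector) set"
    and sE :: "'k::real_or_complex \<Rightarrow> 'e \<Rightarrow> 'e"
  assumes compact: "compact (UNIV :: 'x set)" and sE: "K_normed_space sE"
    and V: "V \<subseteq> C_space" "module.subspace (fscale sE) V"
    and u: "real_linear_on (fscale scaleR) V u"
    and C: "0 \<le> C" "\<And>f. f \<in> V \<Longrightarrow> u f \<le> C * sup_norm f"
  obtains U where "\<forall>f\<in>V. U f = u f" "real_linear_on (fscale scaleR) (M_hull sE V) U"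
    "\<forall>f\<in>M_hull sE V. \<bar>U f\<bar> \<le> C * sup_norm f" "weakly_seq_continuous_on sE (M_hull sE V) U"
proof -
  obtain \<rho> and j :: 'k where "scalar_parts \<rho> j" by (rule ex_scalar_parts)
  then interpret scalar_parts \<rho> j .
  have V_linf: "V \<subseteq> linf" using V(1) by (auto simp: C_space_def)
  let ?M = "M_hull sE V"
  note M_linf = subsetD[OF M_hull_least(1)[OF V_linf, of sE]]
  obtain N :: "('x \<times> ('e \<Rightarrow> real)) measure" where N: "emeasure N (space N) = ennreal C"
    and N_meas: "\<And>f. f \<in> V \<Longrightarrow> eval_fun f \<in> borel_measurable N"
    and N_int: "\<And>f. f \<in> V \<Longrightarrow> integral\<^sup>L N (eval_fun f) = u f"
    using dominated_functional_eval_fun_integral[OF compact V(1)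
        real_subspace_of_K_subspace[OF sE V(2)] u C]
    by metis
  interpret finite_measure N by standard (simp add: N)
  have meas: "eval_fun f \<in> borel_measurable N" if "f \<in> ?M" for f
    using V_linf that
  proof (induct rule: M_hull_induct)
    case (limit fs f)
    show ?case
      using bounded_weak_conv_eval_fun[OF sE limit(4)] limit(2) by (rule borel_measurable_LIMSEQ_real)
  qed (rule N_meas)
  have int: "integrable N (eval_fun f)" if "f \<in> ?M" for f
    using that by (intro integrable_const_bound[of _ "sup_norm f"] meas)
      (simp_all add: abs_eval_fun_le_sup_norm M_linf)
  define U where "U = (\<lambda>f. integral\<^sup>L N (eval_fun f))"
  show ?thesis
  proof (rule that)
    show "\<forall>f\<in>V. U f = u f" by (simp add: U_def N_int)
    have "eval_fun (f + g) = (\<lambda>z. eval_fun f z + eval_fun g z)" for f g :: "'x \<Rightarrow> 'e"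
      using eval_fun_add[of f g] by (simp add: fun_eq_iff)
    then show "real_linear_on (fscale scaleR) ?M U"
      unfolding real_linear_on_def by (auto simp: U_def eval_fun_scale int)
    show "\<forall>f\<in>?M. \<bar>U f\<bar> \<le> C * sup_norm f"
    proof
      fix f assume f: "f \<in> ?M"
      have "\<bar>U f\<bar> \<le> integral\<^sup>L N (\<lambda>z. norm (eval_fun f z))"
        unfolding U_def real_norm_def[symmetric] by (rule integral_norm_bound)
      also have "\<dots> \<le> integral\<^sup>L N (\<lambda>z. sup_norm f)"
        using int[OF f] abs_eval_fun_le_sup_norm[OF M_linf[OF f]] by (intro integral_mono) auto
      also have "\<dots> = C * sup_norm f" using C(1) by (simp add: measure_def N)
      finally show "\<bar>U f\<bar> \<le> C * sup_norm f" .
    qed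
    show "weakly_seq_continuous_on sE ?M U"
      unfolding weakly_seq_continuous_on_def
    proof (intro allI ballI impI, elim conjE)
      fix fs f assume f: "f \<in> ?M" and fs: "\<forall>n. fs n \<in> ?M" and conv: "bounded_weak_conv sE fs f"
      \<comment> \<open>The uniform bound of the sequence is an integrable majorant because
        \<open>N\<close> is finite.\<close>
      obtain B where "\<And>n z. norm (fs n z) \<le> B" using conv unfolding bounded_weak_conv_iff by blast
      then have B: "norm (eval_fun (fs n) z) \<le> B" for n z
        using order_trans[OF abs_eval_fun_le[of "fs n" "fst z" "snd z"]] by simp
      show "(\<lambda>n. U (fs n)) \<longlonglongrightarrow> U f"
        unfolding U_def
        by (rule integral_dominated_convergence[where w = "\<lambda>z. B"])
          (use f fs meas B bounded_weak_conv_eval_fun[OF sE conv] in auto)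
    qed
  qed
qed

section \<open>Extension of operators\<close>

lemma op_norm_cong: "(\<And>f. f \<in> A \<Longrightarrow> T f = T' f) \<Longrightarrow> op_norm A N N' T = op_norm A N N' T'"
  unfolding op_norm_def by (intro arg_cong[of _ _ Sup] image_cong) auto

lemma sup_norm_zero: "sup_norm 0 = 0"
  by (simp add: sup_norm_def)

lemma sup_norm_fscale_real:
  assumes "f \<in> linf" shows "sup_norm (fscale scaleR r f) = \<bar>r\<bar> * sup_norm f"
proof (rule antisym)
  have le: "sup_norm (fscale scaleR r f) \<le> \<bar>r\<bar> * sup_norm f" if "f \<in> linf" for r and f :: "'a \<Rightarrow> 'b"
    by (rule sup_norm_least) (simp add: fscale_def mult_left_mono norm_le_sup_norm that)
  then show "sup_norm (fscale scaleR r f) \<le> \<bar>r\<bar> * sup_norm f" using assms .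
  show "\<bar>r\<bar> * sup_norm f \<le> sup_norm (fscale scaleR r f)"
  proof (cases "r = 0")
    case False
    have "sup_norm (fscale scaleR (1 / r) (fscale scaleR r f)) \<le> \<bar>1 / r\<bar> * sup_norm (fscale scaleR r f)"
      by (intro le linf_fscale[OF K_normed_space_scaleR] assms)
    then show ?thesis using False by (simp add: fscale_def field_simps)
  qed (use sup_norm_nonneg[OF linf_fscale[OF K_normed_space_scaleR assms]] in simp)
qed

text \<open>Instantiated twice, with \<open>T\<close> on \<open>V\<close> and with \<open>T'\<close>
  on the hull, so that the facts on continuity and operator norms serve both.\<close>

locale operator_into_dual =
  fixes sE :: "'k::real_or_complex \<Rightarrow> 'e::real_normed_vector \<Rightarrow> 'e"
    and sF :: "'k \<Rightarrow> 'f::real_normed_vector \<Rightarrow> 'f"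
    and A :: "('x \<Rightarrow> 'e) set" and T :: "('x \<Rightarrow> 'e) \<Rightarrow> 'f \<Rightarrow> 'k"
  assumes sE: "K_normed_space sE" and sF: "K_normed_space sF" and A_linf: "A \<subseteq> linf"
    and operator: "linear_operator (fscale sE) (fscale (*)) A (dual_space sF) T"
begin

lemma subspace_A: "0 \<in> A" "f \<in> A \<Longrightarrow> g \<in> A \<Longrightarrow> f + g \<in> A" "f \<in> A \<Longrightarrow> fscale sE c f \<in> A"
  using operator by (auto simp: linear_operator_def fscale_subspace_iff[OF sE])

lemma T_dual: "f \<in> A \<Longrightarrow> T f \<in> dual_space sF"
  using operator by (auto simp: linear_operator_def)

lemma T_bounded_linear: "f \<in> A \<Longrightarrow> bounded_linear (T f)"
  using T_dual by (auto simp: dual_space_def)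

lemma T_arg_scale: "f \<in> A \<Longrightarrow> T f (sF c y) = c * T f y"
  using T_dual by (auto simp: dual_space_def)

lemma T_add: "f \<in> A \<Longrightarrow> g \<in> A \<Longrightarrow> T (f + g) = T f + T g"
  using operator by (auto simp: linear_operator_def)

lemma T_scale: "f \<in> A \<Longrightarrow> T (fscale sE c f) = fscale (*) c (T f)"
  using operator by (auto simp: linear_operator_def)

lemma real_scale: "fscale scaleR r f = fscale sE (of_real r) f"
  by (simp add: fscale_def K_normed_space.scale_of_real[OF sE])

lemma real_scale_A: "f \<in> A \<Longrightarrow> fscale scaleR r f \<in> A"
  by (simp add: real_scale subspace_A)

lemma T_real_scale: "f \<in> A \<Longrightarrow> T (fscale scaleR r f) y = of_real r * T f y"
  by (simp add: real_scale T_scale) (simp add: fscale_def)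

lemma T_diff: "f \<in> A \<Longrightarrow> g \<in> A \<Longrightarrow> f - g \<in> A \<and> T (f - g) = T f - T g"
proof -
  assume fg: "f \<in> A" "g \<in> A"
  let ?h = "fscale scaleR (- 1) g"
  have h: "?h \<in> A" by (rule real_scale_A[OF fg(2)])
  have "T ?h = - T g" using T_real_scale[OF fg(2), of "- 1"] by (simp add: fun_eq_iff)
  then have "T (f + ?h) = T f - T g" using T_add[OF fg(1) h] by simp
  moreover have "f + ?h = f - g" by (simp add: fscale_def fun_eq_iff)
  ultimately show ?thesis using subspace_A(2)[OF fg(1) h] by simp
qed

lemma T_zero: "T 0 = 0"
  using T_diff[OF subspace_A(1) subspace_A(1)] by simp

lemma onorm_T_zero: "onorm (T 0) = 0"
  by (simp add: T_zero onorm_def)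

lemma zero_in_unit_ball: "0 \<in> {f \<in> A. sup_norm f \<le> 1}"
  by (simp add: subspace_A(1) sup_norm_zero)

lemma onorm_T_real_scale: "f \<in> A \<Longrightarrow> onorm (T (fscale scaleR r f)) = \<bar>r\<bar> * onorm (T f)"
  using onorm_scaleR[OF T_bounded_linear, of f r] T_real_scale[of f r]
  by (simp add: onorm_def scaleR_conv_of_real)

lemma zero_sup_norm: "f \<in> A \<Longrightarrow> sup_norm f = 0 \<Longrightarrow> f = 0"
  using norm_le_sup_norm[OF subsetD[OF A_linf]] by (fastforce simp: fun_eq_iff)

text \<open>Homogeneity carries a bound at norm \<open>b\<close> over to all of \<open>A\<close>.\<close>

lemma onorm_T_le:
  assumes b: "0 < b" and bound: "\<And>g. g \<in> A \<Longrightarrow> sup_norm g = b \<Longrightarrow> onorm (T g) \<le> B" and f: "f \<in> A"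
  shows "onorm (T f) \<le> B / b * sup_norm f"
proof (cases "sup_norm f = 0")
  case True
  then have "f = 0" by (rule zero_sup_norm[OF f])
  then show ?thesis by (simp add: onorm_T_zero sup_norm_zero)
next
  case False
  then have pos: "0 < sup_norm f" using sup_norm_nonneg A_linf f by (metis less_eq_real_def subsetD)
  let ?r = "b / sup_norm f"
  have "onorm (T (fscale scaleR ?r f)) \<le> B"
    using f A_linf pos b by (intro bound real_scale_A) (auto simp: sup_norm_fscale_real)
  then show ?thesis using pos b by (simp add: onorm_T_real_scale[OF f] field_simps)
qed

section \<open>Continuity, boundedness and the operator norm\<close>

lemma metric_space_A: "Metric_space A (\<lambda>f g. \<bar>sup_norm (f - g)\<bar>)"
  by (rule Metric_space_sup_norm[OF A_linf])

lemma continuous_map_T_iff: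
  "continuous_map (norm_topology A sup_norm) (norm_topology (dual_space sF) onorm) T \<longleftrightarrow>
    (\<forall>f\<in>A. \<forall>\<epsilon>>0. \<exists>\<delta>>0. \<forall>g. g \<in> A \<and> \<bar>sup_norm (f - g)\<bar> < \<delta> \<longrightarrow> \<bar>onorm (T f - T g)\<bar> < \<epsilon>)"
  unfolding norm_topology_def
    Metric_space.metric_continuous_map[OF metric_space_A Metric_space_dual]
  using T_dual by blast

lemma continuous_imp_bounded:
  assumes "continuous_map (norm_topology A sup_norm) (norm_topology (dual_space sF) onorm) T"
  obtains B where "\<forall>f\<in>A. onorm (T f) \<le> B * sup_norm f"
proof -
  obtain \<delta> where \<delta>: "0 < \<delta>"
    "\<And>g. g \<in> A \<Longrightarrow> \<bar>sup_norm (0 - g)\<bar> < \<delta> \<Longrightarrow> \<bar>onorm (T 0 - T g)\<bar> < 1"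
    using assms subspace_A(1) unfolding continuous_map_T_iff by (meson zero_less_one)
  \<comment> \<open>Half of \<open>\<delta>\<close>, since continuity at 0 speaks of functions of
    norm strictly below \<open>\<delta>\<close>.\<close>
  have "onorm (T g) \<le> 1" if g: "g \<in> A" "sup_norm g = \<delta> / 2" for g
  proof -
    have "sup_norm (0 - g) = sup_norm g" by (simp add: sup_norm_def)
    moreover have "onorm (T 0 - T g) = onorm (T g)" by (simp add: T_zero onorm_def)
    ultimately show ?thesis using \<delta>(2)[OF g(1)] g(2) \<delta>(1) by simp
  qed
  then have "\<forall>f\<in>A. onorm (T f) \<le> 1 / (\<delta> / 2) * sup_norm f"
    using onorm_T_le[of "\<delta> / 2" 1] \<delta>(1) by simp
  then show ?thesis by (rule that)
qed

lemma bounded_imp_continuous: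
  assumes B: "\<And>f. f \<in> A \<Longrightarrow> onorm (T f) \<le> B * sup_norm f"
  shows "continuous_map (norm_topology A sup_norm) (norm_topology (dual_space sF) onorm) T"
  unfolding continuous_map_T_iff
proof (intro ballI allI impI)
  fix f and \<epsilon> :: real assume f: "f \<in> A" and \<epsilon>: "0 < \<epsilon>"
  \<comment> \<open>\<open>\<bar>B\<bar> + 1\<close> because \<open>B\<close> may have any sign and
    the divisor must be positive.\<close>
  have "\<bar>onorm (T f - T g)\<bar> < \<epsilon>" if g: "g \<in> A" "\<bar>sup_norm (f - g)\<bar> < \<epsilon> / (\<bar>B\<bar> + 1)" for g
  proof -
    have fg: "f - g \<in> A" "T (f - g) = T f - T g" using T_diff[OF f g(1)] by auto
    have "onorm (T f - T g) \<le> B * sup_norm (f - g)" using B[OF fg(1)] fg(2) by simp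
    also have "\<dots> \<le> (\<bar>B\<bar> + 1) * \<bar>sup_norm (f - g)\<bar>"
      using sup_norm_nonneg[OF subsetD[OF A_linf fg(1)]] by (intro mult_mono) auto
    also have "\<dots> < \<epsilon>" using g(2) by (simp add: pos_less_divide_eq mult.commute)
    finally show ?thesis using onorm_pos_le[OF T_bounded_linear[OF fg(1)]] fg(2) by simp
  qed
  moreover have "0 < \<epsilon> / (\<bar>B\<bar> + 1)" using \<epsilon> by simp
  ultimately show "\<exists>\<delta>>0. \<forall>g. g \<in> A \<and> \<bar>sup_norm (f - g)\<bar> < \<delta> \<longrightarrow> \<bar>onorm (T f - T g)\<bar> < \<epsilon>"
    by blast
qed

lemma op_norm_le:
  assumes "0 \<le> B" "\<And>f. f \<in> A \<Longrightarrow> onorm (T f) \<le> B * sup_norm f"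
  shows "op_norm A sup_norm onorm T \<le> B"
  unfolding op_norm_def
proof (rule cSUP_least)
  show "{f \<in> A. sup_norm f \<le> 1} \<noteq> {}" using zero_in_unit_ball by blast
  show "onorm (T f) \<le> B" if "f \<in> {f \<in> A. sup_norm f \<le> 1}" for f
    using assms(2)[of f] mult_left_mono[OF _ assms(1), of "sup_norm f" 1] that by auto
qed

lemma bdd_above_op_norm:
  assumes "\<And>f. f \<in> A \<Longrightarrow> onorm (T f) \<le> B * sup_norm f"
  shows "bdd_above ((\<lambda>f. onorm (T f)) ` {f \<in> A. sup_norm f \<le> 1})"
proof (rule bdd_aboveI2)
  fix f assume f: "f \<in> {f \<in> A. sup_norm f \<le> 1}"
  have "B * sup_norm f \<le> \<bar>B\<bar> * 1"
    using f sup_norm_nonneg[of f] A_linf by (intro mult_mono) auto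
  then show "onorm (T f) \<le> \<bar>B\<bar>" using assms[of f] f by simp
qed

text \<open>Any bound \<open>B\<close> ensures that the supremum in \<open>op_norm\<close> is over a
  set bounded above; that supremum is then itself a valid constant.\<close>

lemma onorm_T_le_op_norm:
  assumes "\<And>f. f \<in> A \<Longrightarrow> onorm (T f) \<le> B * sup_norm f" and f: "f \<in> A"
  shows "onorm (T f) \<le> op_norm A sup_norm onorm T * sup_norm f"
proof -
  have "onorm (T g) \<le> op_norm A sup_norm onorm T" if "g \<in> A" "sup_norm g = 1" for g
    unfolding op_norm_def using that by (intro cSUP_upper bdd_above_op_norm[of B] assms(1)) auto
  from onorm_T_le[OF zero_less_one this f] show ?thesis by simp
qed

lemma op_norm_nonneg:
  assumes "\<And>f. f \<in> A \<Longrightarrow> onorm (T f) \<le> B * sup_norm f"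
  shows "0 \<le> op_norm A sup_norm onorm T"
proof -
  have "onorm (T 0) \<le> op_norm A sup_norm onorm T"
    unfolding op_norm_def by (intro cSUP_upper[OF zero_in_unit_ball] bdd_above_op_norm[of B] assms)
  then show ?thesis by (simp add: onorm_T_zero)
qed

end

text \<open>A functional \<open>c\<close> is recovered from real parts as \<open>c y = \<rho> (c y) - j * \<rho> (c (sF j y))\<close>, so that it
  suffices to extend \<open>\<lambda>f. \<rho> (T f y)\<close> for each \<open>y\<close>; linearity in \<open>f\<close> and \<open>y\<close> is inherited from \<open>T\<close> by
  uniqueness of extensions.\<close>

lemma operator_extension:
  fixes sE :: "'k::real_or_complex \<Rightarrow> 'e::real_normed_vector \<Rightarrow> 'e"
    and sF :: "'k \<Rightarrow> 'f::real_normed_vector \<Rightarrow> 'f"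
    and V :: "('x::t2_space \<Rightarrow> 'e) set"
  assumes compact: "compact (UNIV :: 'x set)"
    and sE: "K_normed_space sE" and sF: "K_normed_space sF"
    and V: "V \<subseteq> C_space"
    and T: "linear_operator (fscale sE) (fscale (*)) V (dual_space sF) T"
    and C: "0 \<le> C" "\<And>f. f \<in> V \<Longrightarrow> onorm (T f) \<le> C * sup_norm f"
  obtains T' where "linear_operator (fscale sE) (fscale (*)) (M_hull sE V) (dual_space sF) T'"
    "\<forall>f\<in>V. T' f = T f" "\<forall>f\<in>M_hull sE V. onorm (T' f) \<le> C * sup_norm f"
    "\<forall>y. weakly_seq_continuous_on sE (M_hull sE V) (\<lambda>f. T' f y)"
proof -
  obtain \<rho> and j :: 'k where "scalar_parts \<rho> j" by (rule ex_scalar_parts)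
  then interpret scalar_parts \<rho> j .
  interpret F: K_normed_space sF by (rule sF)
  have V_linf: "V \<subseteq> linf" using V by (auto simp: C_space_def)
  interpret T: operator_into_dual sE sF V T by (rule operator_into_dual.intro[OF sE sF V_linf T])
  let ?M = "M_hull sE V"
  have subV: "module.subspace (fscale sE) V" using T by (simp add: linear_operator_def)
  have subM: "module.subspace (fscale sE) ?M" by (rule M_hull_subspace[OF sE V_linf subV])
  then have M_scale: "fscale sE c f \<in> ?M" if "f \<in> ?M" for f c
    using that by (simp add: fscale_subspace_iff[OF sE])
  note VM = subsetD[OF M_hull_least(2)[OF V_linf, of sE]]
    and M_linf = subsetD[OF M_hull_least(1)[OF V_linf, of sE]]
  have "\<exists>U. (\<forall>f\<in>V. U f = \<rho> (T f y)) \<and> real_linear_on (fscale scaleR) ?M U \<and>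
      (\<forall>f\<in>?M. \<bar>U f\<bar> \<le> C * norm y * sup_norm f) \<and> weakly_seq_continuous_on sE ?M U" for y
  proof -
    have lin: "real_linear_on (fscale scaleR) V (\<lambda>f. \<rho> (T f y))"
      by (auto simp: real_linear_on_def T.T_add \<rho>_add T.T_real_scale \<rho>_of_real_mult)
    have bound: "\<rho> (T f y) \<le> C * norm y * sup_norm f" if f: "f \<in> V" for f
    proof -
      have "\<rho> (T f y) \<le> norm (T f y)" using abs_\<rho>_le[of "T f y"] by simp
      also have "\<dots> \<le> onorm (T f) * norm y" by (rule onorm[OF T.T_bounded_linear[OF f]])
      also have "\<dots> \<le> C * sup_norm f * norm y" by (rule mult_right_mono[OF C(2)[OF f]]) simp
      finally show ?thesis by (simp add: ac_simps)
    qed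
    have C': "0 \<le> C * norm y" using C(1) by simp
    show ?thesis
      by (rule real_functional_extension[OF compact sE V subV lin C' bound], assumption)
        (intro exI conjI)
  qed
  then obtain U where U_V: "\<And>y f. f \<in> V \<Longrightarrow> U y f = \<rho> (T f y)"
    and U_lin: "\<And>y. real_linear_on (fscale scaleR) ?M (U y)"
    and U_le: "\<And>y f. f \<in> ?M \<Longrightarrow> \<bar>U y f\<bar> \<le> C * norm y * sup_norm f"
    and U_cont: "\<And>y. weakly_seq_continuous_on sE ?M (U y)"
    by metis
  define T' where "T' = (\<lambda>f y. of_real (U y f) - j * of_real (U (sF j y) f))"
  have T'_V: "T' f = T f" if f: "f \<in> V" for f
    using parts[of "T f y" for y] by (auto simp: T'_def U_V[OF f] T.T_arg_scale[OF f] fun_eq_iff)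
  have cont: "weakly_seq_continuous_on sE ?M (\<lambda>f. T' f y)" for y
    using U_cont[of y] U_cont[of "sF j y"]
    by (auto simp: weakly_seq_continuous_on_def T'_def
        intro!: tendsto_diff tendsto_mult_left tendsto_of_real)
  have add: "T' (f + g) y = T' f y + T' g y" if "f \<in> ?M" "g \<in> ?M" for f g y
  proof -
    have "U y (f + g) = U y f + U y g" for y using U_lin that unfolding real_linear_on_def by blast
    then show ?thesis by (simp add: T'_def algebra_simps)
  qed
  \<comment> \<open>Scaling by \<open>j\<close> relates \<open>U y\<close> to
    \<open>U (sF j y)\<close>, and different \<open>y\<close> come with unrelated choices of
    measures. So, unlike additivity in \<open>f\<close>, this identity and the two in
    \<open>y\<close> below cannot be read off from the integrals and go through uniqueness.\<close>
  have scale: "T' (fscale sE c f) y = c * T' f y" if f: "f \<in> ?M" for c f y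
  proof (rule weakly_seq_continuous_on_unique[where U = "\<lambda>f. T' (fscale sE c f) y"
        and U' = "\<lambda>f. c * T' f y", OF V_linf _ _ _ f])
    show "weakly_seq_continuous_on sE ?M (\<lambda>f. T' (fscale sE c f) y)"
      unfolding weakly_seq_continuous_on_def
    proof (intro allI ballI impI, elim conjE)
      fix fs f assume "f \<in> ?M" "\<forall>n. fs n \<in> ?M" "bounded_weak_conv sE fs f"
      then show "(\<lambda>n. T' (fscale sE c (fs n)) y) \<longlonglongrightarrow> T' (fscale sE c f) y"
        using cont[of y, unfolded weakly_seq_continuous_on_def, THEN spec, of "\<lambda>n. fscale sE c (fs n)"]
        by (simp add: M_scale bounded_weak_conv_fscale[OF sE])
    qed
    show "weakly_seq_continuous_on sE ?M (\<lambda>f. c * T' f y)"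
      using cont[of y] by (auto simp: weakly_seq_continuous_on_def intro!: tendsto_mult_left)
    show "T' (fscale sE c f) y = c * T' f y" if "f \<in> V" for f
      using that by (simp add: T'_V T.subspace_A(3) T.T_scale) (simp add: fscale_def)
  qed
  have arg_add: "T' f (y + y') = T' f y + T' f y'" if f: "f \<in> ?M" for f y y'
  proof (rule weakly_seq_continuous_on_unique[where U = "\<lambda>f. T' f (y + y')"
        and U' = "\<lambda>f. T' f y + T' f y'", OF V_linf cont _ _ f])
    show "weakly_seq_continuous_on sE ?M (\<lambda>f. T' f y + T' f y')"
      using cont[of y] cont[of y'] by (auto simp: weakly_seq_continuous_on_def intro!: tendsto_add)
    show "T' f (y + y') = T' f y + T' f y'" if "f \<in> V" for f
      using linear_add[OF bounded_linear.linear[OF T.T_bounded_linear[OF that]]] by (simp add: T'_V that)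
  qed
  have arg_scale: "T' f (sF c y) = c * T' f y" if f: "f \<in> ?M" for f c y
  proof (rule weakly_seq_continuous_on_unique[where U = "\<lambda>f. T' f (sF c y)"
        and U' = "\<lambda>f. c * T' f y", OF V_linf cont _ _ f])
    show "weakly_seq_continuous_on sE ?M (\<lambda>f. c * T' f y)"
      using cont[of y] by (auto simp: weakly_seq_continuous_on_def intro!: tendsto_mult_left)
    show "T' f (sF c y) = c * T' f y" if "f \<in> V" for f by (simp add: T'_V that T.T_arg_scale)
  qed
  have norm_le: "norm (T' f y) \<le> C * sup_norm f * norm y" if f: "f \<in> ?M" for f y
  proof (cases "T' f y = 0")
    case True
    then show ?thesis using C(1) sup_norm_nonneg[OF M_linf[OF f]] by simp
  next
    case False
    \<comment> \<open>Rotating \<open>y\<close> by \<open>a\<close> makes the value real and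
      nonnegative, hence equal to its real part \<open>U (sF a y) f\<close>; this preserves the
      constant \<open>C\<close>.\<close>
    define a where "a = of_real (norm (T' f y)) / T' f y"
    have "norm a = 1" using False by (simp add: a_def norm_divide)
    have "T' f (sF a y) = of_real (norm (T' f y))" using False by (simp add: arg_scale[OF f] a_def)
    moreover have "\<rho> (T' f (sF a y)) = U (sF a y) f" by (simp add: T'_def \<rho>_parts)
    ultimately have "norm (T' f y) = U (sF a y) f" by (simp add: \<rho>_of_real)
    also have "\<dots> \<le> C * norm (sF a y) * sup_norm f" using U_le[OF f, of "sF a y"] by simp
    finally show ?thesis by (simp add: F.norm_scale \<open>norm a = 1\<close> ac_simps)
  qed
  show ?thesis
  proof (rule that)
    have "bounded_linear (T' f)" if f: "f \<in> ?M" for f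
    proof (rule bounded_linear_intro[of _ "C * sup_norm f"])
      show "T' f (r *\<^sub>R y) = r *\<^sub>R T' f y" for r y
        using arg_scale[OF f, of "of_real r" y] by (simp add: F.scale_of_real scaleR_conv_of_real)
      show "norm (T' f y) \<le> norm y * (C * sup_norm f)" for y
        using norm_le[OF f, of y] by (simp add: ac_simps)
    qed (rule arg_add[OF f])
    then have "T' f \<in> dual_space sF" if "f \<in> ?M" for f
      using that by (simp add: dual_space_def arg_scale)
    then show "linear_operator (fscale sE) (fscale (*)) ?M (dual_space sF) T'"
      using subM by (auto simp: linear_operator_def fun_eq_iff add scale fscale_def[of "(*)"])
    show "\<forall>f\<in>V. T' f = T f" by (simp add: T'_V)
    show "\<forall>f\<in>?M. onorm (T' f) \<le> C * sup_norm f"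
      using C(1) norm_le by (auto intro!: onorm_bound mult_nonneg_nonneg sup_norm_nonneg M_linf)
    show "\<forall>y. weakly_seq_continuous_on sE ?M (\<lambda>f. T' f y)" using cont by blast
  qed
qed

text \<open>Weak* convergence is pointwise convergence once all values lie in
  \<open>dual_space sF\<close>; hence the case distinction on
  \<open>linear_operator\<close>.\<close>

lemma weak_seq_extension_iff:
  "weak_seq_extension sE sF V T T' \<longleftrightarrow>
     linear_operator (fscale sE) (fscale (*)) (M_hull sE V) (dual_space sF) T' \<and>
     (\<forall>f\<in>V. T' f = T f) \<and> (\<forall>y. weakly_seq_continuous_on sE (M_hull sE V) (\<lambda>f. T' f y))"
proof (cases "linear_operator (fscale sE) (fscale (*)) (M_hull sE V) (dual_space sF) T'")
  case True
  then have "T' f \<in> dual_space sF" if "f \<in> M_hull sE V" for f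
    using that by (auto simp: linear_operator_def)
  then have "limitin (weak_star_topology sF) (\<lambda>n. T' (fs n)) (T' f) sequentially \<longleftrightarrow>
      (\<forall>y. (\<lambda>n. T' (fs n) y) \<longlonglongrightarrow> T' f y)" if "f \<in> M_hull sE V" "\<forall>n. fs n \<in> M_hull sE V" for fs f
    using that by (intro limitin_weak_star_topology_iff) auto
  then show ?thesis
    unfolding weak_seq_extension_def weakly_seq_continuous_on_def by blast
qed (simp add: weak_seq_extension_def)

theorem theorem1p2:
  fixes sE :: "'k::real_or_complex \<Rightarrow> 'e::banach \<Rightarrow> 'e"
    and sF :: "'k \<Rightarrow> 'f::banach \<Rightarrow> 'f"
    and V :: "('x::t2_space \<Rightarrow> 'e) set"
    and T :: "('x \<Rightarrow> 'e) \<Rightarrow> 'f \<Rightarrow> 'k"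
  assumes "compact (UNIV :: 'x set)"
    and "K_normed_space sE" and "K_normed_space sF"
    and "V \<subseteq> C_space" and "module.subspace (fscale sE) V"
    and "linear_operator (fscale sE) (fscale (*)) V (dual_space sF) T"
    and "continuous_map (norm_topology V sup_norm) (norm_topology (dual_space sF) onorm) T"
  shows "\<exists>T'. weak_seq_extension sE sF V T T' \<and>
           (\<forall>S. weak_seq_extension sE sF V T S \<longrightarrow> (\<forall>f\<in>M_hull sE V. S f = T' f)) \<and>
           continuous_map (norm_topology (M_hull sE V) sup_norm)
             (norm_topology (dual_space sF) onorm) T' \<and>
           op_norm (M_hull sE V) sup_norm onorm T' = op_norm V sup_norm onorm T"
proof -
  have V_linf: "V \<subseteq> linf" using assms(4) by (auto simp: C_space_def)
  interpret T: operator_into_dual sE sF V T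
    by (rule operator_into_dual.intro[OF assms(2,3) V_linf assms(6)])
  obtain B where "\<forall>f\<in>V. onorm (T f) \<le> B * sup_norm f"
    by (rule T.continuous_imp_bounded[OF assms(7)])
  then have B: "onorm (T f) \<le> B * sup_norm f" if "f \<in> V" for f using that by blast
  \<comment> \<open>With the optimal constant for \<open>T\<close>, the bound inherited by
    \<open>T'\<close> is already one half of the norm equality.\<close>
  define C where "C = op_norm V sup_norm onorm T"
  have C: "0 \<le> C" unfolding C_def by (rule T.op_norm_nonneg[OF B])
  have T_le: "onorm (T f) \<le> C * sup_norm f" if "f \<in> V" for f
    unfolding C_def by (rule T.onorm_T_le_op_norm[OF B that])
  obtain T' where T': "linear_operator (fscale sE) (fscale (*)) (M_hull sE V) (dual_space sF) T'"
    and T'_V: "\<forall>f\<in>V. T' f = T f"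
    and T'_le: "\<forall>f\<in>M_hull sE V. onorm (T' f) \<le> C * sup_norm f"
    and T'_cont: "\<forall>y. weakly_seq_continuous_on sE (M_hull sE V) (\<lambda>f. T' f y)"
    by (rule operator_extension[OF assms(1-4,6) C T_le])
  interpret T': operator_into_dual sE sF "M_hull sE V" T'
    by (rule operator_into_dual.intro[OF assms(2,3) M_hull_least(1)[OF V_linf] T'])
  have le: "onorm (T' f) \<le> C * sup_norm f" if "f \<in> M_hull sE V" for f using T'_le that by blast
  have "S f = T' f" if S: "weak_seq_extension sE sF V T S" and f: "f \<in> M_hull sE V" for S f
  proof
    fix y
    show "S f y = T' f y"
      by (rule weakly_seq_continuous_on_unique[where U = "\<lambda>f. S f y" and U' = "\<lambda>f. T' f y",
            OF V_linf _ _ _ f])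
        (use S T'_cont T'_V in \<open>auto simp: weak_seq_extension_iff\<close>)
  qed
  moreover have "weak_seq_extension sE sF V T T'"
    using T' T'_V T'_cont by (simp add: weak_seq_extension_iff)
  moreover have "continuous_map (norm_topology (M_hull sE V) sup_norm)
      (norm_topology (dual_space sF) onorm) T'"
    by (rule T'.bounded_imp_continuous[OF le])
  moreover have "op_norm (M_hull sE V) sup_norm onorm T' = C"
  proof (rule antisym)
    show "op_norm (M_hull sE V) sup_norm onorm T' \<le> C" by (rule T'.op_norm_le[OF C le])
    have "C = op_norm V sup_norm onorm T'" unfolding C_def using T'_V by (intro op_norm_cong) simp
    also have "\<dots> \<le> op_norm (M_hull sE V) sup_norm onorm T'"
      unfolding op_norm_def
    proof (rule cSUP_subset_mono[OF _ T'.bdd_above_op_norm[OF le]])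
      show "{f \<in> V. sup_norm f \<le> 1} \<noteq> {}" using T.zero_in_unit_ball by blast
    qed (use M_hull_least(2)[OF V_linf, of sE] in auto)
    finally show "C \<le> op_norm (M_hull sE V) sup_norm onorm T'" .
  qed
  ultimately show ?thesis unfolding C_def by blast
qed

end
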